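(* Let $M/K$ be obtained by general normal magnification from $L/K$ through $J/K$. Then (1) $[M:K]=[L:K]\cdot[J:K]$ and $s_K(M)=s_K(L)\cdot s_K(J)$. (2) $r_K(M)=r_K(L)\cdot r_K(J)$ and $l_K(M)=l_K(L)\cdot l_K(J)$. (3) $t_K(M)=t_K(L)\cdot t_K(J)$ and $u_K(M)=u_K(L)\cdot u_K(J)$. (4) $i_K(M)=i_K(L)\cdot i_K(J)$ and $a_K(M)=a_K(L)\cdot a_K(J)$.
   Context: $K$ is any field (not necessarily perfect) with a fixed algebraic closure $\bar K$; all extensions are finite and contained in $\bar K$. A tilde denotes normal closure over $K$ in $\bar K$. A finite extension $M/K$ is obtained by general normal magnification from a subextension $L/K$ through a finite extension $J/K$ if $[L:K]>1$, the normal closures $\tilde L$ and $\tilde J$ are linearly disjoint over $K$, and $LJ=M$. For an extension $E/K$, let $E_S$ be its maximal separable subextension, $E_I$ its maximal purely inseparable subextension, $F$ its largest Galois subextension over $K$ and $F'$ its largest normal subextension over $K$. Then $r_K(E)=|\mathrm{Aut}(E/K)|$; $s_K(E)$ is the number of distinct subfields of $\bar K$ isomorphic to $E$ over $K$; $l_K(E)=[E:E_S]\cdot r_K(E)$; $t_K(E)=[F:K]$; $u_K(E)=[E_S:F]$; $i_K(E)=[E_I:K]$; $a_K(E)=[F':K]$. *)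

theory Defs
  imports "HOL-Algebra.Algebra"
begin

(* Omega is an algebraic closure of its subfield K; extensions of K are subfields of Omega
   containing K. *)

definition subextension :: "('a, 'b) ring_scheme \<Rightarrow> 'a set \<Rightarrow> 'a set \<Rightarrow> 'a set \<Rightarrow> bool" where
  "subextension \<Omega> K E F \<longleftrightarrow> subfield F \<Omega> \<and> K \<subseteq> F \<and> F \<subseteq> E"

definition finite_ext :: "('a, 'b) ring_scheme \<Rightarrow> 'a set \<Rightarrow> 'a set \<Rightarrow> bool" where
  "finite_ext \<Omega> K E \<longleftrightarrow>
     subextension \<Omega> K (carrier \<Omega>) E \<and> ring.finite_dimension \<Omega> K E"

(* The normal, separable, purely inseparable and Galois predicates below are meant for subfields
   E with K \<subseteq> E \<subseteq> Omega, which are automatically algebraic over K. *)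

(* As Omega is algebraically closed, p splits over E iff all its roots in Omega lie in E.
   (The library's splitted_on intersects with mset_set E, which is empty for infinite E and
   ignores multiplicities, so it is not the right notion here.) *)
definition normal_ext :: "('a, 'b) ring_scheme \<Rightarrow> 'a set \<Rightarrow> 'a set \<Rightarrow> bool" where
  "normal_ext \<Omega> K E \<longleftrightarrow>
     (\<forall>p \<in> carrier (univ_poly \<Omega> K). pirreducible\<^bsub>\<Omega>\<^esub> K p \<longrightarrow> (\<exists>x \<in> E. ring.is_root \<Omega> p x) \<longrightarrow>
        (\<forall>y. ring.is_root \<Omega> p y \<longrightarrow> y \<in> E))"

definition separable_ext :: "('a, 'b) ring_scheme \<Rightarrow> 'a set \<Rightarrow> 'a set \<Rightarrow> bool" where
  "separable_ext \<Omega> K E \<longleftrightarrow>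
     (\<forall>x \<in> E. \<forall>y. ring.is_root \<Omega> (ring.Irr \<Omega> K x) y \<longrightarrow> ring.alg_mult \<Omega> (ring.Irr \<Omega> K x) y = 1)"

definition galois_ext :: "('a, 'b) ring_scheme \<Rightarrow> 'a set \<Rightarrow> 'a set \<Rightarrow> bool" where
  "galois_ext \<Omega> K E \<longleftrightarrow> normal_ext \<Omega> K E \<and> separable_ext \<Omega> K E"

(* The order of 1 in the additive group is 0 if that order is infinite, so it is the
   characteristic. *)
definition char_exponent :: "('a, 'b) ring_scheme \<Rightarrow> nat" where
  "char_exponent \<Omega> =
     (let c = group.ord (add_monoid \<Omega>) \<one>\<^bsub>\<Omega>\<^esub> in if c = 0 then 1 else c)"

definition purely_insep_ext :: "('a, 'b) ring_scheme \<Rightarrow> 'a set \<Rightarrow> 'a set \<Rightarrow> bool" where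
  "purely_insep_ext \<Omega> K E \<longleftrightarrow> (\<forall>x \<in> E. \<exists>n::nat. x [^]\<^bsub>\<Omega>\<^esub> (char_exponent \<Omega> ^ n) \<in> K)"

definition normal_closure :: "('a, 'b) ring_scheme \<Rightarrow> 'a set \<Rightarrow> 'a set \<Rightarrow> 'a set" where
  "normal_closure \<Omega> K E = (LEAST N. subextension \<Omega> K (carrier \<Omega>) N \<and> normal_ext \<Omega> K N \<and> E \<subseteq> N)"

definition linearly_disjoint :: "('a, 'b) ring_scheme \<Rightarrow> 'a set \<Rightarrow> 'a set \<Rightarrow> 'a set \<Rightarrow> bool" where
  "linearly_disjoint \<Omega> K A B \<longleftrightarrow>
     (\<forall>us. set us \<subseteq> A \<longrightarrow> ring.independent \<Omega> K us \<longrightarrow> ring.independent \<Omega> B us)"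

definition general_normal_magnification ::
    "('a, 'b) ring_scheme \<Rightarrow> 'a set \<Rightarrow> 'a set \<Rightarrow> 'a set \<Rightarrow> 'a set \<Rightarrow> bool" where
  "general_normal_magnification \<Omega> K M L J \<longleftrightarrow>
     finite_ext \<Omega> K M \<and> subextension \<Omega> K M L \<and> finite_ext \<Omega> K J \<and>
     ring.dim \<Omega> K L > 1 \<and>
     linearly_disjoint \<Omega> K (normal_closure \<Omega> K L) (normal_closure \<Omega> K J) \<and>
     generate_field \<Omega> (L \<union> J) = M"

definition max_separable :: "('a, 'b) ring_scheme \<Rightarrow> 'a set \<Rightarrow> 'a set \<Rightarrow> 'a set" where
  "max_separable \<Omega> K E = (GREATEST F. subextension \<Omega> K E F \<and> separable_ext \<Omega> K F)"

definition max_purely_insep :: "('a, 'b) ring_scheme \<Rightarrow> 'a set \<Rightarrow> 'a set \<Rightarrow> 'a set" where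
  "max_purely_insep \<Omega> K E = (GREATEST F. subextension \<Omega> K E F \<and> purely_insep_ext \<Omega> K F)"

definition max_galois :: "('a, 'b) ring_scheme \<Rightarrow> 'a set \<Rightarrow> 'a set \<Rightarrow> 'a set" where
  "max_galois \<Omega> K E = (GREATEST F. subextension \<Omega> K E F \<and> galois_ext \<Omega> K F)"

definition max_normal :: "('a, 'b) ring_scheme \<Rightarrow> 'a set \<Rightarrow> 'a set \<Rightarrow> 'a set" where
  "max_normal \<Omega> K E = (GREATEST F. subextension \<Omega> K E F \<and> normal_ext \<Omega> K F)"

definition ext_isos :: "('a, 'b) ring_scheme \<Rightarrow> 'a set \<Rightarrow> 'a set \<Rightarrow> 'a set \<Rightarrow> ('a \<Rightarrow> 'a) set" where
  "ext_isos \<Omega> K E E' =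
     {\<sigma> \<in> ring_iso (\<Omega>\<lparr>carrier := E\<rparr>) (\<Omega>\<lparr>carrier := E'\<rparr>). \<forall>x \<in> K. \<sigma> x = x}"

(* Extensionality identifies HOL functions that agree on E, so that the cardinality is
   meaningful. *)
definition ext_aut :: "('a, 'b) ring_scheme \<Rightarrow> 'a set \<Rightarrow> 'a set \<Rightarrow> ('a \<Rightarrow> 'a) set" where
  "ext_aut \<Omega> K E = ext_isos \<Omega> K E E \<inter> extensional E"

definition r_ext :: "('a, 'b) ring_scheme \<Rightarrow> 'a set \<Rightarrow> 'a set \<Rightarrow> nat" where
  "r_ext \<Omega> K E = card (ext_aut \<Omega> K E)"

definition s_ext :: "('a, 'b) ring_scheme \<Rightarrow> 'a set \<Rightarrow> 'a set \<Rightarrow> nat" where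
  "s_ext \<Omega> K E = card {E'. subextension \<Omega> K (carrier \<Omega>) E' \<and> ext_isos \<Omega> K E E' \<noteq> {}}"

definition l_ext :: "('a, 'b) ring_scheme \<Rightarrow> 'a set \<Rightarrow> 'a set \<Rightarrow> nat" where
  "l_ext \<Omega> K E = ring.dim \<Omega> (max_separable \<Omega> K E) E * r_ext \<Omega> K E"

definition t_ext :: "('a, 'b) ring_scheme \<Rightarrow> 'a set \<Rightarrow> 'a set \<Rightarrow> nat" where
  "t_ext \<Omega> K E = ring.dim \<Omega> K (max_galois \<Omega> K E)"

definition u_ext :: "('a, 'b) ring_scheme \<Rightarrow> 'a set \<Rightarrow> 'a set \<Rightarrow> nat" where
  "u_ext \<Omega> K E = ring.dim \<Omega> (max_galois \<Omega> K E) (max_separable \<Omega> K E)"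

definition i_ext :: "('a, 'b) ring_scheme \<Rightarrow> 'a set \<Rightarrow> 'a set \<Rightarrow> nat" where
  "i_ext \<Omega> K E = ring.dim \<Omega> K (max_purely_insep \<Omega> K E)"

definition a_ext :: "('a, 'b) ring_scheme \<Rightarrow> 'a set \<Rightarrow> 'a set \<Rightarrow> nat" where
  "a_ext \<Omega> K E = ring.dim \<Omega> K (max_normal \<Omega> K E)"

end

theory Submission
  imports Defs "HOL-Computational_Algebra.Primes"
begin

text \<open>Let \<open>N\<close> and \<open>N'\<close> be the normal closures of \<open>L\<close> and \<open>J\<close>. As they are linearly disjoint,
  embeddings of \<open>L\<close> and of \<open>J\<close> can be combined to embeddings of \<open>M = LJ\<close>, and \<open>L'J' \<inter> N = L'\<close> for
  conjugates \<open>L'\<close>, \<open>J'\<close>. So automorphisms and conjugate fields of \<open>M\<close> correspond to pairs of those of \<open>L\<close> and \<open>J\<close>.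
  All other invariants reduce to degrees, which are multiplicative, once the largest separable (normal,
  purely inseparable, Galois) subextension of \<open>M\<close> is known to be the compositum of those of \<open>L\<close> and \<open>J\<close>.
  For the normal and the purely inseparable one, write \<open>z \<in> M\<close> in terms of a \<open>K\<close>-basis of \<open>L\<close> and
  let the embeddings of \<open>J\<close> act on the coordinates: the coordinates inherit the property of \<open>z\<close>. Then
  exchange the roles of \<open>L\<close> and \<open>J\<close>. For the separable one, some \<open>z\<^sup>Q\<close> with \<open>Q\<close> a power of the characteristic exponent \<open>q\<close>
  lies in the compositum of the separable parts, and a separable \<open>z\<close> lies in \<open>K(z\<^sup>Q)\<close>.
  Separability is handled throughout by the criterion \<open>z \<in> K(z\<^sup>q)\<close>.\<close>

section \<open>Linear algebra\<close>

text \<open>The hypothesis concerns the normal closures because embeddings of \<open>L\<close> and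
  \<open>J\<close> move elements out of these fields but never out of \<open>N\<close> and
  \<open>N'\<close>. Coordinates of an element of \<open>M\<close> that have been moved by an
  embedding must still be unique, and this uniqueness holds only over a field that contains all
  their conjugates. The definition of linear disjointness treats the two fields differently, so its
  symmetry is needed before the roles of \<open>L\<close> and \<open>J\<close> can be exchanged. All
  fields here are algebraic over \<open>K\<close>, so a subring containing \<open>K\<close> is
  already a field. A set is therefore recognised as an extension by its ring operations alone. The
  criterion \<open>z \<in> K(z^q)\<close> covers all characteristics at once: \<open>q\<close> is 1
  in characteristic zero and the condition is then void. It is carried along by embeddings and can
  be checked by counting dimensions, because the \<open>q\<close>-th power map is additive and
  injective and sends \<open>K\<close> into itself. Formal derivatives occur only once, in the
  comparison of the criterion with root multiplicities. The largest Galois subextension is the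
  normal part of the separable part, so it needs no argument of its own.\<close>

context ring
begin

text \<open>Interchange of the two summations in a finite double sum, with the coefficient matrix
  given by the list of rows \<open>Css\<close>. It drives the symmetry of linear
  disjointness.\<close>

lemma combine_swap:
  assumes "length Css = length us" "set us \<subseteq> carrier R" "set as \<subseteq> carrier R"
    and "\<And>c. c \<in> set Css \<Longrightarrow> length c = length as \<and> set c \<subseteq> carrier R"
    and comm: "\<And>x y. x \<in> carrier R \<Longrightarrow> y \<in> carrier R \<Longrightarrow> x \<otimes> y = y \<otimes> x"
  shows "combine (map (\<lambda>c. combine c as) Css) us =
    combine (map (\<lambda>j. combine (map (\<lambda>c. c ! j) Css) us) [0..<length as]) as"
  using assms(1,2,4)
proof (induction Css us rule: list_induct2)
  case Nil
  have "map (\<lambda>j. combine (map (\<lambda>c. c ! j) []) []) [0..<length as] = replicate (length as) \<zero>"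
    by (simp add: map_replicate_const)
  then show ?case using combine_replicate[OF assms(3)] by simp
next
  case (Cons c Css u us)
  let ?bs = "map (\<lambda>j. combine (map (\<lambda>c. c ! j) Css) us) [0..<length as]"
  have c: "length c = length as" "set c \<subseteq> carrier R" and u: "u \<in> carrier R" "set us \<subseteq> carrier R"
    using Cons.prems by auto
  have bs: "set ?bs \<subseteq> carrier R"
  proof -
    have "combine (map (\<lambda>c. c ! j) Css) us \<in> carrier R" if "j < length as" for j
      using Cons.prems that u by (intro combine_in_carrier) (auto, metis nth_mem subsetD)
    then show ?thesis by auto
  qed
  have uc: "set (map ((\<otimes>) u) c) \<subseteq> carrier R" using u c by auto
  have "combine c as \<otimes> u = combine (map ((\<otimes>) u) c) as"
    using combine_r_distr[OF c(2) assms(3) u(1)] comm u(1) c(2) assms(3) by simp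
  then have "combine (map (\<lambda>c. combine c as) (c # Css)) (u # us) =
      combine (map ((\<otimes>) u) c) as \<oplus> combine ?bs as"
    using Cons.IH Cons.prems u by simp
  also have "\<dots> = combine (map2 (\<oplus>) (map ((\<otimes>) u) c) ?bs) as"
    by (rule combine_add) (use c bs uc assms(3) in auto)
  also have "map2 (\<oplus>) (map ((\<otimes>) u) c) ?bs =
      map (\<lambda>j. combine (map (\<lambda>c. c ! j) (c # Css)) (u # us)) [0..<length as]"
    using c u comm by (intro nth_equalityI) (auto, metis nth_mem subsetD)
  finally show ?case .
qed

text \<open>Each further vector either lies in the span of the others or raises the dimension by
  one. The full length is reached only if every vector raises it.\<close>

lemma Span_dimension_le:
  assumes "subfield K R" "set us \<subseteq> carrier R"
  shows "\<exists>k \<le> length us. dimension k K (Span K us) \<and> (k = length us \<longrightarrow> independent K us)"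
  using assms(2)
proof (induction us)
  case Nil
  then show ?case by auto
next
  case (Cons u us)
  then obtain k where k: "k \<le> length us" "dimension k K (Span K us)"
    "k = length us \<longrightarrow> independent K us" by auto
  have us: "set us \<subseteq> carrier R" "u \<in> carrier R" using Cons.prems by auto
  show ?case
  proof (cases "u \<in> Span K us")
    case True
    have "set (u # us) \<subseteq> Span K us" using True Span_base_incl[OF assms(1) us(1)] by simp
    then have "Span K (u # us) \<subseteq> Span K us" by (rule mono_Span_subset[OF assms(1) _ us(1)])
    then have "Span K (u # us) = Span K us" using mono_Span[OF assms(1) us] by auto
    then show ?thesis using k by (intro exI[of _ k]) auto
  next
    case False
    then have "dimension (Suc k) K (Span K (u # us))"
      using Suc_dim[OF us(2) False k(2)] by simp
    then show ?thesis using k False us by (intro exI[of _ "Suc k"]) (auto intro: li_Cons)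
  qed
qed

end

context field
begin

text \<open>In a relation among \<open>us\<close> with coefficients in \<open>A\<close>, expand the
  coefficients in a \<open>K\<close>-basis \<open>as\<close> of their span and interchange the sums.
  The result is a relation among \<open>as\<close> over \<open>B\<close>; its coefficients vanish by
  assumption, and being \<open>K\<close>-combinations of \<open>us\<close> they force all matrix
  entries to vanish.\<close>

lemma linearly_disjoint_sym:
  assumes K: "subfield K R" and A: "subfield A R" and B: "subfield B R"
    and KA: "K \<subseteq> A" and KB: "K \<subseteq> B"
    and ld: "linearly_disjoint R K A B"
  shows "linearly_disjoint R K B A"
  unfolding linearly_disjoint_def
proof (intro allI impI)
  fix us assume us: "set us \<subseteq> B" "independent K us"
  have usR: "set us \<subseteq> carrier R" using independent_in_carrier us(2) by blast
  have AR: "A \<subseteq> carrier R" "B \<subseteq> carrier R" using subfieldE(3) A B by blast+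
  have KR: "K \<subseteq> carrier R" using subfieldE(3) K by blast
  show "independent A us"
  proof (rule ccontr)
    assume "dependent A us"
    then obtain Ks where Ks: "length Ks = length us" "combine Ks us = \<zero>" "set Ks \<subseteq> A" "set Ks \<noteq> {\<zero>}"
      using dependent_imp_non_trivial_combine[OF A usR] by metis
    have KsR: "set Ks \<subseteq> carrier R" using Ks AR by auto
    obtain as where as: "set as \<subseteq> carrier R" "independent K as" "Span K as = Span K Ks"
      using filter_base[OF K KsR] by blast
    have "subalgebra K A R"
      using KA A by (intro subalgebra.intro subalgebra_axioms.intro)
        (auto simp: subring.axioms(1)[OF subfieldE(1)] subringE[OF subfieldE(1)])
    then have "Span K Ks \<subseteq> A" using subalgebra_Span_incl[OF K _ Ks(3)] by blast
    moreover have "set as \<subseteq> Span K as" by (rule Span_base_incl[OF K as(1)])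
    ultimately have asA: "set as \<subseteq> A" using as(3) by auto
    then have asB: "independent B as" using ld as unfolding linearly_disjoint_def by blast
    have "\<exists>c. set c \<subseteq> K \<and> length c = length as \<and> k = combine c as" if "k \<in> set Ks" for k
    proof -
      have "k \<in> Span K as" using that Span_base_incl[OF K KsR] as(3) by auto
      then show ?thesis using Span_mem_iff_length_version[OF K as(1)] by blast
    qed
    then obtain f where f: "\<And>k. k \<in> set Ks \<Longrightarrow> set (f k) \<subseteq> K \<and> length (f k) = length as \<and> k = combine (f k) as"
      by metis
    define Css where "Css = map f Ks"
    have Ks_eq: "Ks = map (\<lambda>c. combine c as) Css"
      unfolding Css_def by (rule nth_equalityI) (use f in auto)
    let ?b = "\<lambda>j. combine (map (\<lambda>c. c ! j) Css) us"
    have ent: "c ! j \<in> K" if "c \<in> set Css" "j < length as" for c j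
      using that f nth_mem unfolding Css_def by fastforce
    have "combine (map ?b [0..<length as]) as = \<zero>"
      using combine_swap[of Css us as] Ks usR as(1) m_comm Ks_eq f KR
      unfolding Css_def by (smt (verit, best) in_set_conv_nth length_map nth_map subset_trans)
    moreover have bB: "?b j \<in> B" if "j < length as" for j
    proof -
      have "set (map (\<lambda>c. c ! j) Css) \<subseteq> K" using ent that by auto
      then have "?b j \<in> Span K us" unfolding Span_eq_combine_set[OF K usR] by blast
      moreover have "subalgebra K B R"
        using KB B by (intro subalgebra.intro subalgebra_axioms.intro)
          (auto simp: subring.axioms(1)[OF subfieldE(1)] subringE[OF subfieldE(1)])
      ultimately show ?thesis using subalgebra_Span_incl[OF K _ us(1)] by blast
    qed
    ultimately have "set (take (length as) (map ?b [0..<length as])) \<subseteq> {\<zero>}"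
      by (intro independent_imp_trivial_combine[OF B asB]) auto
    then have b0: "?b j = \<zero>" if "j < length as" for j using that by (auto simp: image_subset_iff)
    have "c ! j = \<zero>" if "c \<in> set Css" "j < length as" for c j
    proof -
      have "set (take (length us) (map (\<lambda>c. c ! j) Css)) \<subseteq> {\<zero>}"
        using ent that by (intro independent_imp_trivial_combine[OF K us(2)] b0) auto
      then show ?thesis using that Ks(1) unfolding Css_def by auto
    qed
    then have "c = replicate (length as) \<zero>" if "c \<in> set Css" for c
      using that f unfolding Css_def by (intro nth_equalityI) auto
    then have "set Ks \<subseteq> {\<zero>}"
      using combine_replicate[OF as(1)] Ks_eq by auto
    \<comment> \<open>An empty \<open>Ks\<close> would make \<open>us\<close> empty, and the empty
      list is independent.\<close>
    moreover have "set Ks \<noteq> {}" using Ks(2-4) \<open>dependent A us\<close> Ks(1) by auto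
    ultimately show False using Ks(4) by (simp add: subset_singleton_iff)
  qed
qed

text \<open>The span contains a basis of \<open>E\<close>, so its dimension is at least
  \<open>n\<close>, while \<open>n\<close> vectors span a space of dimension \<open>n\<close> only
  if they are independent.\<close>

lemma dimension_spanning_list:
  assumes K: "subfield K R" and "dimension n K E" "set us \<subseteq> carrier R" "length us = n"
    and "E \<subseteq> Span K us"
  shows "independent K us"
proof -
  obtain vs where vs: "set vs \<subseteq> carrier R" "independent K vs" "length vs = n" "Span K vs = E"
    using exists_base[OF K assms(2)] by blast
  obtain k where k: "k \<le> length us" "dimension k K (Span K us)" "k = length us \<longrightarrow> independent K us"
    using Span_dimension_le[OF K assms(3)] by blast
  have "set vs \<subseteq> Span K us" using Span_base_incl[OF K vs(1)] vs(4) assms(5) by auto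
  then have "n \<le> k" using independent_length_le_dimension[OF K k(2) vs(2)] vs(3) by simp
  then show ?thesis using k assms(4) by simp
qed

lemma subfield_is_subalgebra:
  assumes "subfield E R" "K \<subseteq> E"
  shows "subalgebra K E R"
  using assms by (intro subalgebra.intro subalgebra_axioms.intro)
        (auto simp: subring.axioms(1)[OF subfieldE(1)] subringE[OF subfieldE(1)])

end

section \<open>Binomial theorem, evaluation as a sum, and formal derivatives\<close>

context cring
begin

lemma binomial:
  assumes x: "x \<in> carrier R" and y: "y \<in> carrier R"
  shows "(x \<oplus> y) [^] n = (\<Oplus>k\<in>{..n}. add_pow R (n choose k) (x [^] k \<otimes> y [^] (n - k)))"
proof (induction n)
  case 0
  then show ?case by simp
next
  case (Suc n)
  let ?S = "\<Oplus>k\<in>{..n}. add_pow R (n choose k) (x [^] k \<otimes> y [^] (n - k))"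
  let ?t = "\<lambda>k. x [^] Suc k \<otimes> y [^] (n - k)"
  have tc: "?t k \<in> carrier R" for k using x y by simp
  have Sx: "?S \<otimes> x = (\<Oplus>k\<in>{..n}. add_pow R (n choose k) (?t k))"
    using x y by (subst finsum_ldistr)
      (auto intro!: finsum_cong' simp: add_pow_ldistr add_pow_rdistr m_ac)
  have Sy: "?S \<otimes> y = (\<Oplus>k\<in>{..n}. add_pow R (n choose k) (x [^] k \<otimes> y [^] (Suc n - k)))"
    using x y by (subst finsum_ldistr)
      (auto intro!: finsum_cong' simp: add_pow_ldistr m_assoc Suc_diff_le)
  \<comment> \<open>The added summand has binomial coefficient zero. With it the sum can be split at
    \<open>k = 0\<close> and shifted, ready for Pascal's rule.\<close>
  also have "\<dots> = (\<Oplus>k\<in>{..Suc n}. add_pow R (n choose k) (x [^] k \<otimes> y [^] (Suc n - k)))"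
    using x y by (subst finsum_Suc) (auto simp: Pi_def binomial_eq_0)
  also have "\<dots> = (\<Oplus>k\<in>{..n}. add_pow R (n choose Suc k) (?t k)) \<oplus> y [^] Suc n"
    using x y by (subst finsum_Suc2) (auto simp: Pi_def)
  finally have Sy': "?S \<otimes> y = (\<Oplus>k\<in>{..n}. add_pow R (n choose Suc k) (?t k)) \<oplus> y [^] Suc n" .
  have "(\<Oplus>k\<in>{..Suc n}. add_pow R (Suc n choose k) (x [^] k \<otimes> y [^] (Suc n - k))) =
      (\<Oplus>k\<in>{..n}. add_pow R (Suc n choose Suc k) (?t k)) \<oplus> y [^] Suc n"
    using x y by (subst finsum_Suc2) (auto simp: Pi_def)
  also have "(\<Oplus>k\<in>{..n}. add_pow R (Suc n choose Suc k) (?t k)) =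
      (\<Oplus>k\<in>{..n}. add_pow R (n choose k) (?t k) \<oplus> add_pow R (n choose Suc k) (?t k))"
    using tc by (intro finsum_cong') (auto simp: add.nat_pow_mult)
  also have "\<dots> = ?S \<otimes> x \<oplus> (\<Oplus>k\<in>{..n}. add_pow R (n choose Suc k) (?t k))"
    unfolding Sx using tc by (intro finsum_addf) auto
  finally have "(\<Oplus>k\<in>{..Suc n}. add_pow R (Suc n choose k) (x [^] k \<otimes> y [^] (Suc n - k))) = ?S \<otimes> x \<oplus> ?S \<otimes> y"
    unfolding Sy' using x y tc by (simp add: a_assoc Pi_def)
  moreover have "?S \<in> carrier R" using x y by (intro finsum_closed) auto
  ultimately show ?case using Suc x y by (simp add: r_distr)
qed

text \<open>Coefficients beyond the length are zero, so any large enough \<open>n\<close> is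
  allowed. This makes sums for different polynomials comparable.\<close>

lemma eval_eq_finsum:
  assumes "set p \<subseteq> carrier R" "x \<in> carrier R" "length p \<le> n"
  shows "eval p x = (\<Oplus>i\<in>{..<n}. coeff p i \<otimes> x [^] i)"
proof -
  have *: "eval p x = (\<Oplus>i\<in>{..<length p}. coeff p i \<otimes> x [^] i)"
    using assms(1)
  proof (induction p)
    case (Cons a p)
    have "(\<Oplus>i\<in>{..<length p}. coeff (a # p) i \<otimes> x [^] i) = (\<Oplus>i\<in>{..<length p}. coeff p i \<otimes> x [^] i)"
      using Cons assms(2) by (intro finsum_cong') auto
    then show ?case
      using Cons assms(2) by (simp add: lessThan_Suc finsum_insert Pi_def)
  qed simp
  also have "\<dots> = (\<Oplus>i\<in>{..<n}. coeff p i \<otimes> x [^] i)"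
    using assms by (intro add.finprod_mono_neutral_cong_left) (auto simp: coeff_length)
  finally show ?thesis .
qed

text \<open>Polynomials are lists with the leading coefficient first, hence the reversal when a list
  is built from its coefficient function.\<close>

lemma coeff_map_rev:
  assumes "i < n"
  shows "coeff (map f (rev [0..<n])) i = f i"
  using assms by (subst coeff_nth) (auto simp: rev_nth)

text \<open>The left-hand side is the derivative of \<open>p = (X - x) h\<close> evaluated at \<open>x\<close>, up to degree \<open>N\<close>.\<close>

lemma derivative_telescope:
  assumes x: "x \<in> carrier R" and h: "\<And>i. h i \<in> carrier R"
    and c: "\<And>i. c i = (if i = 0 then \<zero> else h (i - 1)) \<ominus> x \<otimes> h i"
  shows "(\<Oplus>i\<in>{..<N::nat}. [Suc i] \<cdot> (c (Suc i) \<otimes> x [^] i)) =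
    (\<Oplus>i\<in>{..<N}. h i \<otimes> x [^] i) \<ominus> [N] \<cdot> (h N \<otimes> x [^] N)"
proof -
  have aux: "(m \<oplus> u \<ominus> w) \<oplus> (A \<ominus> m) = (u \<oplus> A) \<ominus> w"
    if "m \<in> carrier R" "u \<in> carrier R" "w \<in> carrier R" "A \<in> carrier R" for m u w A
    using that by algebra
  show ?thesis
  proof (induction N)
    case 0
    then show ?case using h by (simp add: a_minus_def)
  next
    case (Suc N)
    let ?A = "\<Oplus>i\<in>{..<N}. h i \<otimes> x [^] i"
    have A: "?A \<in> carrier R" using x h by (intro finsum_closed) auto
    define u where "u = h N \<otimes> x [^] N"
    define v where "v = h (Suc N) \<otimes> x [^] Suc N"
    have uv: "u \<in> carrier R" "v \<in> carrier R" unfolding u_def v_def using x h by auto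
    have cc: "c i \<in> carrier R" for i using c x h by auto
    have s: "[Suc N] \<cdot> (c (Suc N) \<otimes> x [^] N) = [N] \<cdot> u \<oplus> u \<ominus> [Suc N] \<cdot> v"
    proof -
      have "c (Suc N) \<otimes> x [^] N = u \<ominus> v"
      proof -
        have "x \<otimes> h (Suc N) \<otimes> x [^] N = v" unfolding v_def using x h by (simp add: m_ac)
        then show ?thesis
          unfolding c u_def using x h by (simp add: a_minus_def l_distr l_minus)
      qed
      moreover have "[Suc N] \<cdot> (u \<ominus> v) = [Suc N] \<cdot> u \<ominus> [Suc N] \<cdot> v"
        using uv by (simp only: a_minus_def add.nat_pow_distrib a_inv_closed add.nat_pow_inv)
      ultimately show ?thesis using uv by simp
    qed
    have "(\<Oplus>i\<in>{..<Suc N}. [Suc i] \<cdot> (c (Suc i) \<otimes> x [^] i)) =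
        [Suc N] \<cdot> (c (Suc N) \<otimes> x [^] N) \<oplus> (\<Oplus>i\<in>{..<N}. [Suc i] \<cdot> (c (Suc i) \<otimes> x [^] i))"
      unfolding lessThan_Suc using cc x by (intro finsum_insert) auto
    also have "\<dots> = ([N] \<cdot> u \<oplus> u \<ominus> [Suc N] \<cdot> v) \<oplus> (?A \<ominus> [N] \<cdot> u)"
      unfolding Suc s u_def ..
    also have "\<dots> = (u \<oplus> ?A) \<ominus> [Suc N] \<cdot> v"
    proof -
      define w where "w = [Suc N] \<cdot> v"
      define m where "m = [N] \<cdot> u"
      have "w \<in> carrier R" "m \<in> carrier R" unfolding w_def m_def using uv by auto
      then show ?thesis using uv A aux unfolding w_def[symmetric] m_def[symmetric] by blast
    qed
    also have "u \<oplus> ?A = (\<Oplus>i\<in>{..<Suc N}. h i \<otimes> x [^] i)"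
      unfolding u_def using x h by (simp add: lessThan_Suc finsum_insert Pi_def)
    finally show ?case unfolding v_def .
  qed
qed

end

section \<open>Embeddings and composita\<close>

locale closure_ext = algebraic_closure \<Omega> K for \<Omega> (structure) and K
begin

declare Span.simps [simp del]

abbreviation ext :: "'a set \<Rightarrow> bool" where
  "ext E \<equiv> subfield E \<Omega> \<and> K \<subseteq> E"

abbreviation compositum :: "'a set \<Rightarrow> 'a set \<Rightarrow> 'a set" where
  "compositum A B \<equiv> generate_field \<Omega> (A \<union> B)"

text \<open>The values outside \<open>E\<close> are arbitrary, so these functions are never counted
  themselves: the counts use images of \<open>E\<close> or functions made extensional.\<close>

definition emb :: "'a set \<Rightarrow> ('a \<Rightarrow> 'a) set" where
  "emb E = {f \<in> ring_hom (\<Omega>\<lparr>carrier := E\<rparr>) \<Omega>. \<forall>x \<in> K. f x = x}"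

lemma K_field: "subfield K \<Omega>"
  by (rule subfield_axioms)

lemma ext_K: "ext K"
  using K_field by simp

lemma ext_carrier: "ext (carrier \<Omega>)"
  using carrier_is_subfield subfieldE(3)[OF K_field] by simp

lemma ext_simps:
  assumes "ext E"
  shows "E \<subseteq> carrier \<Omega>" "\<zero> \<in> E" "\<one> \<in> E" "x \<in> E \<Longrightarrow> x \<in> carrier \<Omega>"
    "x \<in> E \<Longrightarrow> \<ominus> x \<in> E" "x \<in> E \<Longrightarrow> y \<in> E \<Longrightarrow> x \<oplus> y \<in> E" "x \<in> E \<Longrightarrow> y \<in> E \<Longrightarrow> x \<ominus> y \<in> E"
    "x \<in> E \<Longrightarrow> y \<in> E \<Longrightarrow> x \<otimes> y \<in> E" "x \<in> E \<Longrightarrow> x \<noteq> \<zero> \<Longrightarrow> inv x \<in> E"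
    "x \<in> E \<Longrightarrow> x [^] (n::nat) \<in> E"
proof -
  have E: "subfield E \<Omega>" using assms by simp
  note s = subringE[OF subfieldE(1)[OF E]]
  show "E \<subseteq> carrier \<Omega>" "\<zero> \<in> E" "\<one> \<in> E" "x \<in> E \<Longrightarrow> x \<in> carrier \<Omega>"
    "x \<in> E \<Longrightarrow> \<ominus> x \<in> E" "x \<in> E \<Longrightarrow> y \<in> E \<Longrightarrow> x \<oplus> y \<in> E" "x \<in> E \<Longrightarrow> y \<in> E \<Longrightarrow> x \<ominus> y \<in> E"
    "x \<in> E \<Longrightarrow> y \<in> E \<Longrightarrow> x \<otimes> y \<in> E"
    using s by (auto simp: a_minus_def)
  show "x \<in> E \<Longrightarrow> x \<noteq> \<zero> \<Longrightarrow> inv x \<in> E" using subfield_m_inv(1)[OF E] by blast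
  show "x \<in> E \<Longrightarrow> x [^] n \<in> E" using s by (induction n) auto
qed

lemma algebraic_over:
  assumes "ext E" "x \<in> carrier \<Omega>"
  shows "(algebraic over E) x"
  using algebraic_mono algebraic_extension assms by blast

text \<open>Every element \<open>x\<close> is algebraic over \<open>K\<close>, so its inverse lies
  in \<open>K(x)\<close>, which is contained in any ring containing \<open>K\<close> and
  \<open>x\<close>.\<close>

lemma subring_imp_subfield:
  assumes "subring S \<Omega>" "K \<subseteq> S"
  shows "subfield S \<Omega>"
proof (rule subfieldI'[OF assms(1)])
  fix x assume x: "x \<in> S - {\<zero>}"
  then have xR: "x \<in> carrier \<Omega>" using subringE(1)[OF assms(1)] by auto
  have "subfield (simple_extension K x) \<Omega>"
    using simple_extension_is_subfield[OF K_field xR] algebraic_extension[OF xR] by simp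
  then have "inv x \<in> simple_extension K x"
    using subfield_m_inv(1) simple_extension_mem[OF subfieldE(1)[OF K_field] xR] x by blast
  then show "inv x \<in> S" using simple_extension_subring_incl[OF assms] x by auto
qed

lemma ext_simple_extension:
  assumes "ext E" "x \<in> carrier \<Omega>"
  shows "ext (simple_extension E x)"
  using simple_extension_is_subfield algebraic_over[OF assms] assms
    simple_extension_incl[OF ext_simps(1)[OF assms(1)] assms(2)] by blast

lemma ext_finite_extension:
  assumes "ext E" "set xs \<subseteq> carrier \<Omega>"
  shows "ext (finite_extension E xs)"
  using finite_extension_is_subfield[of E xs] algebraic_over[OF assms(1)] assms
    finite_extension_incl[OF ext_simps(1)[OF assms(1)] assms(2)] by blast

lemma ext_compositum:
  assumes "ext A" "ext B"
  shows "ext (compositum A B)"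
proof -
  have AB: "A \<union> B \<subseteq> carrier \<Omega>" using ext_simps(1) assms by blast
  then show ?thesis
    using generate_field_is_subfield[OF AB] generate_fieldE(2)[OF AB refl] assms by blast
qed

lemma compositum_incl:
  assumes "ext A" "ext B"
  shows "A \<subseteq> compositum A B" "B \<subseteq> compositum A B"
proof -
  have AB: "A \<union> B \<subseteq> carrier \<Omega>" using ext_simps(1) assms by blast
  show "A \<subseteq> compositum A B" "B \<subseteq> compositum A B" using generate_fieldE(2)[OF AB refl] by blast+
qed

lemma compositum_least:
  assumes "ext E" "A \<subseteq> E" "B \<subseteq> E"
  shows "compositum A B \<subseteq> E"
  using generate_field_min_subfield1[of "A \<union> B" E] ext_simps(1)[OF assms(1)] assms by blast

lemma mult_Span_closed:
  assumes B: "ext B" and us: "set us \<subseteq> carrier \<Omega>" and vs: "set vs \<subseteq> carrier \<Omega>" and a: "a \<in> carrier \<Omega>"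
    and au: "\<And>u. u \<in> set us \<Longrightarrow> a \<otimes> u \<in> Span B vs" and z: "z \<in> Span B us"
  shows "a \<otimes> z \<in> Span B vs"
proof -
  have Bf: "subfield B \<Omega>" using B by simp
  note Sp = Span_subgroup_props[OF Bf vs] and Sm = Span_smult_closed[OF Bf vs]
  show ?thesis
    using z us au
  proof (induction us arbitrary: z)
    case Nil
    then show ?case using a Sp(2) by (simp add: Span.simps)
  next
    case (Cons u us)
    then obtain k v where kv: "k \<in> B" "v \<in> Span B us" "z = k \<otimes> u \<oplus> v"
      by (auto simp: Span.simps line_extension_mem_iff)
    have c: "k \<in> carrier \<Omega>" "v \<in> carrier \<Omega>" "u \<in> carrier \<Omega>"
      using kv Cons.prems ext_simps(4)[OF B] Span_in_carrier[OF ext_simps(1)[OF B]] by auto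
    have "a \<otimes> z = k \<otimes> (a \<otimes> u) \<oplus> a \<otimes> v" using kv c a by (simp add: r_distr m_lcomm)
    moreover have "a \<otimes> v \<in> Span B vs" using Cons.IH[OF kv(2)] Cons.prems by auto
    ultimately show ?case using Sp(3) Sm kv(1) Cons.prems by auto
  qed
qed

text \<open>By bilinearity, closure under products need only be checked on the spanning vectors.
  \<open>mult_Span_closed\<close> is applied once for each factor.\<close>

lemma Span_subring:
  assumes B: "ext B" and us: "set us \<subseteq> carrier \<Omega>" and one: "\<one> \<in> Span B us"
    and mult: "\<And>u v. u \<in> set us \<Longrightarrow> v \<in> set us \<Longrightarrow> u \<otimes> v \<in> Span B us"
  shows "subring (Span B us) \<Omega>"
proof (rule subringI)
  have Bf: "subfield B \<Omega>" using B by simp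
  note Sp = Span_subgroup_props[OF Bf us]
  show "Span B us \<subseteq> carrier \<Omega>" by (rule Sp(1))
  show "\<one> \<in> Span B us" by (rule one)
  show "\<ominus> z \<in> Span B us" if "z \<in> Span B us" for z using Sp(4) that .
  show "z \<oplus> w \<in> Span B us" if "z \<in> Span B us" "w \<in> Span B us" for z w using Sp(3) that .
  have left: "u \<otimes> z \<in> Span B us" if "u \<in> set us" "z \<in> Span B us" for u z
    by (rule mult_Span_closed[OF B us us _ _ that(2)]) (use that(1) us mult in auto)
  fix w z assume w: "w \<in> Span B us" and z: "z \<in> Span B us"
  show "w \<otimes> z \<in> Span B us"
  proof (rule mult_Span_closed[OF B us us _ _ z])
    show "w \<in> carrier \<Omega>" using w Sp(1) by auto
    show "w \<otimes> u \<in> Span B us" if "u \<in> set us" for u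
    proof -
      have "u \<otimes> w = w \<otimes> u" using that us w Sp(1) by (intro m_comm) auto
      then show ?thesis using left[OF that w] by simp
    qed
  qed
qed

text \<open>Products of elements of \<open>as\<close> lie in \<open>A\<close>, which is spanned by
  \<open>as\<close> already over \<open>K\<close>. So the \<open>B\<close>-span is a ring, hence a
  field, and it contains both \<open>A\<close> and \<open>B\<close>.\<close>

lemma Span_eq_compositum:
  assumes A: "ext A" and B: "ext B" and as: "set as \<subseteq> carrier \<Omega>" "Span K as = A"
  shows "Span B as = compositum A B"
proof
  have Bf: "subfield B \<Omega>" using B by simp
  have asA: "set as \<subseteq> A" using Span_base_incl[OF K_field as(1)] as(2) by simp
  have "subalgebra B (compositum A B) \<Omega>"
    using ext_compositum[OF A B] compositum_incl(2)[OF A B] by (intro subfield_is_subalgebra) auto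
  then show "Span B as \<subseteq> compositum A B"
    by (rule subalgebra_Span_incl[OF Bf]) (use asA compositum_incl(1)[OF A B] in auto)
  let ?S = "Span B as"
  have AS: "A \<subseteq> ?S"
  proof
    fix a assume "a \<in> A"
    then obtain ks where "set ks \<subseteq> K" "a = combine ks as"
      using Span_mem_iff_length_version[OF K_field as(1)] as(2) by blast
    then show "a \<in> ?S" unfolding Span_eq_combine_set[OF Bf as(1)] using B by blast
  qed
  have BS: "B \<subseteq> ?S"
  proof
    fix b assume b: "b \<in> B"
    have "b \<otimes> \<one> \<in> ?S" using Span_smult_closed[OF Bf as(1)] b AS ext_simps(3)[OF A] by blast
    then show "b \<in> ?S" using b ext_simps(4)[OF B] by simp
  qed
  have "subring ?S \<Omega>"
    by (rule Span_subring[OF B as(1)]) (use AS asA ext_simps(3,8)[OF A] in blast)+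
  then have "ext ?S" using subring_imp_subfield[of ?S] BS B by blast
  then show "compositum A B \<subseteq> ?S" using compositum_least AS BS by blast
qed

lemma finite_basis:
  assumes "finite_dimension K A"
  obtains as where "set as \<subseteq> carrier \<Omega>" "independent K as" "Span K as = A" "set as \<subseteq> A" "dimension (length as) K A"
  using assms exists_base[OF K_field] Span_base_incl[OF K_field] by (metis finite_dimensionE')

lemma finite_dimension_subset:
  assumes "finite_dimension K E" "ext F" "F \<subseteq> E"
  shows "finite_dimension K F"
  using subalbegra_incl_imp_finite_dimension[OF K_field assms(1)] subfield_is_subalgebra assms by blast

lemma independent_antimono:
  assumes "subfield F \<Omega>" "subfield E \<Omega>" "F \<subseteq> E" "independent E us"
  shows "independent F us"
  using assms
  by (meson independent_imp_trivial_combine independent_in_carrier subset_trans trivial_combine_imp_independent)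

lemma linearly_disjoint_mono:
  assumes "linearly_disjoint \<Omega> K A B" "A' \<subseteq> A" "B' \<subseteq> B" "ext B" "ext B'"
  shows "linearly_disjoint \<Omega> K A' B'"
  using assms independent_antimono[of B' B] unfolding linearly_disjoint_def by (meson subset_trans)

text \<open>A \<open>K\<close>-basis of \<open>A\<close> remains independent over \<open>B\<close>
  and spans the compositum, so it is a \<open>B\<close>-basis of it. The degree formula for towers
  does the rest.\<close>

lemma dim_compositum:
  assumes A: "ext A" "finite_dimension K A" and B: "ext B" "finite_dimension K B"
    and ld: "linearly_disjoint \<Omega> K A B"
  shows "finite_dimension K (compositum A B)" "dim K (compositum A B) = dim K A * dim K B"
proof -
  obtain as where as: "set as \<subseteq> carrier \<Omega>" "independent K as" "Span K as = A" "set as \<subseteq> A"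
    "dimension (length as) K A" using finite_basis[OF A(2)] .
  obtain m where m: "dimension m K B" using B(2) by blast
  have "independent B as" using ld as(2,4) unfolding linearly_disjoint_def by blast
  then have "dimension (length as) B (compositum A B)"
    using dimension_independent[of B as] Span_eq_compositum[OF A(1) B(1) as(1,3)] by simp
  then have *: "dimension (m * length as) K (compositum A B)"
    using telescopic_base[OF K_field _ m] B(1) by blast
  then show "finite_dimension K (compositum A B)" by (rule finite_dimensionI)
  show "dim K (compositum A B) = dim K A * dim K B"
    using dimI[OF K_field *] dimI[OF K_field m] dimI[OF K_field as(5)] unfolding over_def by simp
qed

text \<open>An element of \<open>N\<close> outside \<open>A\<close> can be added to a
  \<open>K\<close>-basis of \<open>A\<close>. The longer list is independent over \<open>K\<close>
  inside \<open>N\<close>, hence independent over \<open>B\<close>, so the new element is not in the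
  \<open>B\<close>-span of the basis.\<close>

lemma compositum_inter_left:
  assumes A: "ext A" "finite_dimension K A" and B: "ext B" and N: "ext N" "A \<subseteq> N"
    and ld: "linearly_disjoint \<Omega> K N B"
  shows "compositum A B \<inter> N = A"
proof (intro equalityI subsetI)
  fix z assume z: "z \<in> compositum A B \<inter> N"
  obtain as where as: "set as \<subseteq> carrier \<Omega>" "independent K as" "Span K as = A" "set as \<subseteq> A"
    using finite_basis[OF A(2)] .
  show "z \<in> A"
  proof (rule ccontr)
    assume "z \<notin> A"
    then have "independent K (z # as)"
      using as z ext_simps(4)[OF N(1)] by (intro li_Cons) auto
    moreover have "set (z # as) \<subseteq> N" using z as(4) N(2) by auto
    ultimately have "independent B (z # as)" using ld unfolding linearly_disjoint_def by blast
    then have "z \<notin> Span B as" by (rule independent_backwards)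
    then show False using z Span_eq_compositum[OF A(1) B as(1,3)] by blast
  qed
qed (use N(2) compositum_incl[OF A(1) B] in auto)

section \<open>Embeddings over \<open>K\<close> and their gluing on a compositum\<close>

lemma emb_simps:
  assumes "f \<in> emb E" "ext E"
  shows "x \<in> E \<Longrightarrow> f x \<in> carrier \<Omega>" "x \<in> E \<Longrightarrow> y \<in> E \<Longrightarrow> f (x \<oplus> y) = f x \<oplus> f y"
    "x \<in> E \<Longrightarrow> y \<in> E \<Longrightarrow> f (x \<otimes> y) = f x \<otimes> f y" "f \<one> = \<one>" "x \<in> K \<Longrightarrow> f x = x" "f \<zero> = \<zero>"
    "x \<in> E \<Longrightarrow> f (x [^] (n::nat)) = f x [^] n"
proof -
  have h: "f \<in> ring_hom (\<Omega>\<lparr>carrier := E\<rparr>) \<Omega>" using assms unfolding emb_def by simp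
  note r = ring_hom_memE[OF h, simplified]
  show "x \<in> E \<Longrightarrow> f x \<in> carrier \<Omega>" "x \<in> E \<Longrightarrow> y \<in> E \<Longrightarrow> f (x \<oplus> y) = f x \<oplus> f y"
    using r by auto
  show m: "x \<in> E \<Longrightarrow> y \<in> E \<Longrightarrow> f (x \<otimes> y) = f x \<otimes> f y" for x y using r by auto
  show o: "f \<one> = \<one>" using r by auto
  show k: "x \<in> K \<Longrightarrow> f x = x" for x using assms unfolding emb_def by auto
  show "f \<zero> = \<zero>" using k ext_simps(2)[OF ext_K] by auto
  show "x \<in> E \<Longrightarrow> f (x [^] n) = f x [^] n"
    using ext_simps(10)[OF assms(2)] m o by (induction n) auto
qed

lemma embI:
  assumes "\<And>x. x \<in> E \<Longrightarrow> f x \<in> carrier \<Omega>"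
    "\<And>x y. x \<in> E \<Longrightarrow> y \<in> E \<Longrightarrow> f (x \<oplus> y) = f x \<oplus> f y"
    "\<And>x y. x \<in> E \<Longrightarrow> y \<in> E \<Longrightarrow> f (x \<otimes> y) = f x \<otimes> f y"
    "\<And>x. x \<in> K \<Longrightarrow> f x = x"
  shows "f \<in> emb E"
  unfolding emb_def using assms ext_simps(3)[OF ext_K] by (auto intro!: ring_hom_memI)

lemma emb_mono:
  assumes "f \<in> emb E" "ext E" "ext F" "F \<subseteq> E"
  shows "f \<in> emb F"
  using emb_simps[OF assms(1,2)] assms(3,4) by (intro embI) (metis subsetD)+

lemma emb_combine:
  assumes "f \<in> emb E" "ext E" "set ks \<subseteq> E" "set us \<subseteq> E"
  shows "f (combine ks us) = combine (map f ks) (map f us) \<and> combine ks us \<in> E"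
  using assms(3,4)
  by (induction ks us rule: combine.induct) (auto simp: emb_simps[OF assms(1,2)] ext_simps[OF assms(2)])

lemma emb_eval:
  assumes "f \<in> emb E" "ext E" "set p \<subseteq> E" "x \<in> E"
  shows "f (eval p x) = eval (map f p) (f x) \<and> eval p x \<in> E"
  using assms(3,4)
  by (induction p) (auto simp: emb_simps[OF assms(1,2)] ext_simps[OF assms(2)])

lemma emb_a_inv:
  assumes "f \<in> emb E" "ext E" "x \<in> E"
  shows "f (\<ominus> x) = \<ominus> f x"
proof -
  have "f x \<oplus> f (\<ominus> x) = f (x \<oplus> \<ominus> x)"
    using emb_simps(2)[OF assms(1,2)] ext_simps(5)[OF assms(2)] assms(3) by simp
  also have "x \<oplus> \<ominus> x = \<zero>" using assms ext_simps(4)[OF assms(2)] r_neg by blast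
  finally have "f x \<oplus> f (\<ominus> x) = \<zero>" using emb_simps(6)[OF assms(1,2)] by simp
  then show ?thesis
    using emb_simps(1)[OF assms(1,2)] ext_simps(5)[OF assms(2)] assms(3) by (metis minus_equality a_comm)
qed

lemma emb_nonzero:
  assumes "f \<in> emb E" "ext E" "x \<in> E" "x \<noteq> \<zero>"
  shows "f x \<noteq> \<zero>"
proof -
  have U: "x \<in> Units \<Omega>" using assms ext_simps(4)[OF assms(2)] field_Units by blast
  have i: "inv x \<in> E" using ext_simps(9)[OF assms(2)] assms by blast
  have "f x \<otimes> f (inv x) = \<one>"
    using emb_simps(3)[OF assms(1,2) assms(3) i] emb_simps(4)[OF assms(1,2)] U by simp
  then show ?thesis using emb_simps(1)[OF assms(1,2)] i by auto
qed

lemma emb_inj: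
  assumes "f \<in> emb E" "ext E"
  shows "inj_on f E"
proof (rule inj_onI)
  fix x y assume xy: "x \<in> E" "y \<in> E" "f x = f y"
  have "f (x \<ominus> y) = f x \<ominus> f y"
    unfolding a_minus_def using emb_simps(2)[OF assms] emb_a_inv[OF assms] ext_simps(5)[OF assms(2)] xy by simp
  also have "\<dots> = \<zero>" using xy emb_simps(1)[OF assms] by (simp add: r_right_minus_eq)
  finally have "x \<ominus> y = \<zero>" using emb_nonzero[OF assms] ext_simps(7)[OF assms(2)] xy by blast
  then show "x = y" using xy ext_simps(4)[OF assms(2)] by (simp add: r_right_minus_eq)
qed

lemma ext_emb_image:
  assumes "f \<in> emb E" "ext E"
  shows "ext (f ` E)"
proof
  show "K \<subseteq> f ` E" using emb_simps(5)[OF assms] assms(2) by force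
  have "subring (f ` E) \<Omega>"
  proof (rule subringI)
    show "f ` E \<subseteq> carrier \<Omega>" using emb_simps(1)[OF assms] by auto
    show "\<one> \<in> f ` E" using emb_simps(4)[OF assms] ext_simps(3)[OF assms(2)] by (metis imageI)
    fix h assume "h \<in> f ` E"
    then obtain x where x: "x \<in> E" "h = f x" by blast
    show "\<ominus> h \<in> f ` E"
      using emb_a_inv[OF assms x(1)] ext_simps(5)[OF assms(2) x(1)] x(2) by (metis imageI)
    fix k assume "k \<in> f ` E"
    then obtain y where y: "y \<in> E" "k = f y" by blast
    show "h \<otimes> k \<in> f ` E"
      using emb_simps(3)[OF assms x(1) y(1)] ext_simps(8)[OF assms(2) x(1) y(1)] x(2) y(2) by (metis imageI)
    show "h \<oplus> k \<in> f ` E"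
      using emb_simps(2)[OF assms x(1) y(1)] ext_simps(6)[OF assms(2) x(1) y(1)] x(2) y(2) by (metis imageI)
  qed
  then show "subfield (f ` E) \<Omega>" using subring_imp_subfield \<open>K \<subseteq> f ` E\<close> by blast
qed

text \<open>With respect to a \<open>K\<close>-basis of \<open>A\<close>, the elements of the compositum have unique coordinates
  in \<open>B\<close>, so \<open>g\<close> can be applied to the coordinates and \<open>f\<close> to the basis.\<close>

lemma emb_compositum:
  assumes A: "ext A" "finite_dimension K A" and B: "ext B"
    and ld: "linearly_disjoint \<Omega> K A B"
    and f: "f \<in> emb A" and g: "g \<in> emb B"
  obtains \<phi> where "\<phi> \<in> emb (compositum A B)" "\<And>x. x \<in> A \<Longrightarrow> \<phi> x = f x" "\<And>x. x \<in> B \<Longrightarrow> \<phi> x = g x"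
    "\<And>bs as. set bs \<subseteq> B \<Longrightarrow> set as \<subseteq> A \<Longrightarrow> \<phi> (combine bs as) = combine (map g bs) (map f as)"
proof -
  obtain as where as: "set as \<subseteq> carrier \<Omega>" "independent K as" "Span K as = A" "set as \<subseteq> A"
    using finite_basis[OF A(2)] .
  have Bf: "subfield B \<Omega>" using B by simp
  have M: "Span B as = compositum A B" by (rule Span_eq_compositum[OF A(1) B as(1,3)])
  have indB: "independent B as" using ld as(2,4) unfolding linearly_disjoint_def by blast
  define C where "C z = (THE bs. set bs \<subseteq> B \<and> length bs = length as \<and> z = combine bs as)" for z
  define \<phi> where "\<phi> z = combine (map g (C z)) (map f as)" for z
  let ?M = "compositum A B"
  have C: "set (C z) \<subseteq> B \<and> length (C z) = length as \<and> z = combine (C z) as" if "z \<in> ?M" for z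
    using theI'[OF unique_decomposition[OF Bf indB, of z]] that M unfolding C_def by simp
  have Ceq: "C (combine bs as) = bs" if "set bs \<subseteq> B" "length bs = length as" for bs
  proof -
    have "combine bs as \<in> Span B as" unfolding Span_eq_combine_set[OF Bf as(1)] using that by blast
    then have "\<exists>!Ks. set Ks \<subseteq> B \<and> length Ks = length as \<and> combine bs as = combine Ks as"
      by (rule unique_decomposition[OF Bf indB])
    then show ?thesis unfolding C_def by (rule the1_equality) (use that in simp)
  qed
  have \<phi>comb: "\<phi> (combine bs as) = combine (map g bs) (map f as)" if "set bs \<subseteq> B" "length bs = length as" for bs
    using Ceq[OF that] unfolding \<phi>_def by simp
  have BR: "B \<subseteq> carrier \<Omega>" and AR: "A \<subseteq> carrier \<Omega>" using ext_simps(1) A B by blast+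
  have fas: "set (map f as) \<subseteq> carrier \<Omega>" using emb_simps(1)[OF f A(1)] as(4) by auto
  have gc: "set (map g bs) \<subseteq> carrier \<Omega>" if "set bs \<subseteq> B" for bs using emb_simps(1)[OF g B] that by auto
  have extM: "ext ?M" by (rule ext_compositum[OF A(1) B])
  note incl = compositum_incl[OF A(1) B]
  have \<phi>c: "\<phi> z \<in> carrier \<Omega>" if "z \<in> ?M" for z
    using C[OF that] gc fas unfolding \<phi>_def by (intro combine_in_carrier) auto
  have add: "\<phi> (z \<oplus> w) = \<phi> z \<oplus> \<phi> w" if zw: "z \<in> ?M" "w \<in> ?M" for z w
  proof -
    let ?D = "map2 (\<oplus>) (C z) (C w)"
    note cz = C[OF zw(1)] and cw = C[OF zw(2)]
    have D: "set ?D \<subseteq> B" "length ?D = length as"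
    proof -
      show "set ?D \<subseteq> B"
      proof
        fix d assume "d \<in> set ?D"
        then obtain x y where "(x, y) \<in> set (zip (C z) (C w))" "d = x \<oplus> y" by auto
        moreover from this have "x \<in> set (C z)" "y \<in> set (C w)" by (blast dest: set_zip_leftD set_zip_rightD)+
        ultimately show "d \<in> B" using cz cw ext_simps(6)[OF B] by blast
      qed
    qed (use cz cw in auto)
    have "z \<oplus> w = combine ?D as"
      using combine_add[of "C z" as "C w"] cz cw BR as(1) by auto
    then have "\<phi> (z \<oplus> w) = combine (map g ?D) (map f as)" using \<phi>comb[OF D] by simp
    also have "map g ?D = map2 (\<oplus>) (map g (C z)) (map g (C w))"
      using cz cw by (intro nth_equalityI) (auto intro!: emb_simps(2)[OF g B])
    also have "combine \<dots> (map f as) = \<phi> z \<oplus> \<phi> w"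
      unfolding \<phi>_def by (rule combine_add[symmetric]) (use cz cw gc fas in auto)
    finally show ?thesis .
  qed
  have smult: "\<phi> (b \<otimes> z) = g b \<otimes> \<phi> z" if bz: "b \<in> B" "z \<in> ?M" for b z
  proof -
    note cz = C[OF bz(2)]
    let ?D = "map ((\<otimes>) b) (C z)"
    have D: "set ?D \<subseteq> B" "length ?D = length as" using cz ext_simps(8)[OF B] bz by auto
    have "b \<otimes> z = combine ?D as"
      using combine_r_distr[of "C z" as b] cz BR as(1) bz by auto
    then have "\<phi> (b \<otimes> z) = combine (map g ?D) (map f as)" using \<phi>comb[OF D] by simp
    also have "map g ?D = map ((\<otimes>) (g b)) (map g (C z))"
      using cz bz emb_simps(3)[OF g B] by auto
    also have "combine \<dots> (map f as) = g b \<otimes> \<phi> z"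
      unfolding \<phi>_def by (rule combine_r_distr[symmetric]) (use cz bz gc fas emb_simps(1)[OF g B] in auto)
    finally show ?thesis .
  qed
  have onA: "\<phi> a = f a" if "a \<in> A" for a
  proof -
    have "a \<in> Span K as" using as(3) that by simp
    then obtain ks where ks: "set ks \<subseteq> K" "length ks = length as" "a = combine ks as"
      using Span_mem_iff_length_version[OF K_field as(1)] by blast
    have "\<phi> a = combine (map g ks) (map f as)" using \<phi>comb ks B by auto
    also have "map g ks = map f ks" using ks emb_simps(5)[OF g B] emb_simps(5)[OF f A(1)] by auto
    also have "combine \<dots> (map f as) = f a" using emb_combine[OF f A(1), of ks as] ks A(1) as(4) by auto
    finally show ?thesis .
  qed
  have onB: "\<phi> b = g b" if "b \<in> B" for b
    using smult[OF that, of \<one>] onA[of \<one>] emb_simps(4)[OF f A(1)] ext_simps(3)[OF A(1)] incl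
      ext_simps(4)[OF B that] emb_simps(1)[OF g B that] by auto
  \<comment> \<open>Arbitrary lists from \<open>A\<close> are needed here: multiplying the chosen
    basis by an element of \<open>A\<close> does not give the chosen basis again.\<close>
  have gen: "\<phi> (combine bs us) = combine (map g bs) (map f us) \<and> combine bs us \<in> ?M"
    if "set bs \<subseteq> B" "set us \<subseteq> A" for bs us
    using that
  proof (induction bs us rule: combine.induct)
    case (1 b bs u us)
    then have IH: "\<phi> (combine bs us) = combine (map g bs) (map f us)" "combine bs us \<in> ?M"
      and b: "b \<in> B" and u: "u \<in> A" by auto
    have m: "u \<in> ?M" "b \<otimes> u \<in> ?M" using u b incl ext_simps(8)[OF extM] by auto
    then show ?case using add[OF m(2) IH(2)] smult[OF b m(1)] onA[OF u] IH ext_simps(6)[OF extM m(2)] by simp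
  qed (use onA[of \<zero>] emb_simps(6)[OF f A(1)] ext_simps(2)[OF A(1)] ext_simps(2)[OF extM] in auto)
  have multA: "\<phi> (a \<otimes> combine bs us) = f a \<otimes> \<phi> (combine bs us)"
    if "a \<in> A" "set bs \<subseteq> B" "set us \<subseteq> A" for a bs us
  proof -
    have s: "set (map ((\<otimes>) a) us) \<subseteq> A" using that ext_simps(8)[OF A(1)] by auto
    have ac: "a \<in> carrier \<Omega>" "set bs \<subseteq> carrier \<Omega>" "set us \<subseteq> carrier \<Omega>" using that AR BR by auto
    have sc: "f a \<in> carrier \<Omega>" "set (map g bs) \<subseteq> carrier \<Omega>" "set (map f us) \<subseteq> carrier \<Omega>"
      using that emb_simps(1)[OF f A(1)] emb_simps(1)[OF g B] by auto
    have "a \<otimes> combine bs us = combine bs us \<otimes> a" using ac by (intro m_comm combine_in_carrier)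
    also have "\<dots> = combine bs (map (\<lambda>u. u \<otimes> a) us)" using combine_l_distr ac by blast
    also have "map (\<lambda>u. u \<otimes> a) us = map ((\<otimes>) a) us" using ac m_comm by auto
    finally have "\<phi> (a \<otimes> combine bs us) = combine (map g bs) (map f (map ((\<otimes>) a) us))"
      using gen[OF that(2) s] by simp
    also have "map f (map ((\<otimes>) a) us) = map (\<lambda>u. u \<otimes> f a) (map f us)"
      using that emb_simps(1,3)[OF f A(1)] m_comm by auto
    also have "combine (map g bs) \<dots> = combine (map g bs) (map f us) \<otimes> f a"
      using combine_l_distr[OF sc(2,3,1)] by simp
    also have "\<dots> = f a \<otimes> combine (map g bs) (map f us)" using sc by (intro m_comm combine_in_carrier)
    finally show ?thesis using gen[OF that(2,3)] by simp
  qed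
  \<comment> \<open>Induction over the terms of the first factor. The second factor is expanded in
    its coordinates \<open>C w\<close>, so that \<open>multA\<close> applies to each term.\<close>
  have mult: "\<phi> (combine bs us \<otimes> w) = \<phi> (combine bs us) \<otimes> \<phi> w"
    if "w \<in> ?M" "set bs \<subseteq> B" "set us \<subseteq> A" for bs us w
    using that(2,3)
  proof (induction bs us rule: combine.induct)
    case (1 b bs u us)
    have m: "b \<in> ?M" "u \<in> ?M" "combine bs us \<in> ?M" "b \<otimes> u \<in> ?M" "u \<otimes> w \<in> ?M" "combine bs us \<otimes> w \<in> ?M"
      "b \<otimes> (u \<otimes> w) \<in> ?M"
      using 1 incl gen[of bs us] that(1) by (auto intro!: ext_simps(8)[OF extM])
    note c = ext_simps(4)[OF extM]
    have uw: "\<phi> (u \<otimes> w) = f u \<otimes> \<phi> w"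
      using multA[of u "C w" as] C[OF that(1)] 1 as(4) by auto
    have "combine (b # bs) (u # us) \<otimes> w = b \<otimes> (u \<otimes> w) \<oplus> combine bs us \<otimes> w"
      using m[THEN c] c[OF that(1)] by (simp add: l_distr m_assoc)
    then have "\<phi> (combine (b # bs) (u # us) \<otimes> w) = g b \<otimes> (f u \<otimes> \<phi> w) \<oplus> \<phi> (combine bs us) \<otimes> \<phi> w"
      using add[OF m(7) m(6)] smult[OF _ m(5), of b] uw 1 by simp
    also have "\<dots> = (g b \<otimes> f u \<oplus> \<phi> (combine bs us)) \<otimes> \<phi> w"
      using emb_simps(1)[OF g B, of b] emb_simps(1)[OF f A(1), of u] 1 \<phi>c[OF that(1)] \<phi>c[OF m(3)]
      by (simp add: l_distr m_assoc)
    also have "g b \<otimes> f u \<oplus> \<phi> (combine bs us) = \<phi> (combine (b # bs) (u # us))"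
      using gen[of bs us] gen[of "b # bs" "u # us"] 1 by simp
    finally show ?case .
  qed (use onA[of \<zero>] emb_simps(6)[OF f A(1)] ext_simps(2)[OF A(1)] \<phi>c[OF that(1)] ext_simps(4)[OF extM that(1)] in auto)
  have "\<phi> \<in> emb ?M"
  proof (rule embI)
    show "\<phi> (x \<otimes> y) = \<phi> x \<otimes> \<phi> y" if "x \<in> ?M" "y \<in> ?M" for x y
      using mult[OF that(2), of "C x" as] C[OF that(1)] as(4) by auto
  qed (use \<phi>c add onA emb_simps(5)[OF f A(1)] A(1) in auto)
  then show thesis using that onA onB gen by blast
qed


section \<open>Conjugates and normal subextensions\<close>

text \<open>For \<open>x\<close> in a finite extension \<open>E\<close> these are exactly the values
  at \<open>x\<close> of the members of \<open>emb E\<close>, by \<open>emb_conjugates\<close> and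
  \<open>conjugate_emb\<close>. Multiplicities are dropped.\<close>

definition conjugates :: "'a \<Rightarrow> 'a set" where
  "conjugates x = {y. is_root (Irr K x) y}"

lemma Irr_simps:
  assumes "ext E" "x \<in> carrier \<Omega>"
  shows "Irr E x \<in> carrier (E[X])" "pirreducible E (Irr E x)" "lead_coeff (Irr E x) = \<one>"
    "eval (Irr E x) x = \<zero>" "set (Irr E x) \<subseteq> E" "Irr E x \<noteq> []" "Irr E x \<in> carrier (poly_ring \<Omega>)"
    "degree (Irr E x) \<ge> 1"
proof -
  have E: "subfield E \<Omega>" using assms by simp
  show i: "Irr E x \<in> carrier (E[X])" "pirreducible E (Irr E x)" "lead_coeff (Irr E x) = \<one>"
    "eval (Irr E x) x = \<zero>"
    using IrrE[OF E assms(2) algebraic_over[OF assms]] by auto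
  show "Irr E x \<noteq> []" using pirreducibleE(1)[OF subfieldE(1)[OF E] i(1,2)] .
  show "set (Irr E x) \<subseteq> E" using i(1) polynomial_incl univ_poly_carrier by blast
  show "Irr E x \<in> carrier (poly_ring \<Omega>)" using carrier_polynomial_shell[OF subfieldE(1)[OF E] i(1)] .
  show "degree (Irr E x) \<ge> 1" using pirreducible_degree[OF E i(1,2)] .
qed

lemma conjugates_self: "x \<in> carrier \<Omega> \<Longrightarrow> x \<in> conjugates x"
  using Irr_simps[OF ext_K] unfolding conjugates_def is_root_def by auto

lemma conjugates_carrier: "conjugates x \<subseteq> carrier \<Omega>"
  unfolding conjugates_def is_root_def by auto

lemma conjugates_Irr:
  assumes "x \<in> carrier \<Omega>" "y \<in> conjugates x"
  shows "Irr K y = Irr K x"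
proof -
  have y: "y \<in> carrier \<Omega>" "eval (Irr K x) y = \<zero>"
    using assms unfolding conjugates_def is_root_def by auto
  note i = Irr_simps(1-4)[OF ext_K]
  show ?thesis
    using minimal_polynomial_is_unique[OF K_field y(1) algebraic_extension[OF y(1)]]
      i[OF y(1)] i[OF assms(1)] y(2) by blast
qed

lemma emb_conjugates:
  assumes "f \<in> emb E" "ext E" "x \<in> E"
  shows "f x \<in> conjugates x"
proof -
  have x: "x \<in> carrier \<Omega>" using assms ext_simps(4) by blast
  note i = Irr_simps[OF ext_K x]
  have "map f (Irr K x) = Irr K x" using i(5) emb_simps(5)[OF assms(1,2)] by (intro map_idI) auto
  moreover have "f (eval (Irr K x) x) = eval (map f (Irr K x)) (f x)"
    using emb_eval[OF assms(1,2) _ assms(3)] i(5) assms(2) by blast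
  ultimately have "eval (Irr K x) (f x) = \<zero>" using i(4) emb_simps(6)[OF assms(1,2)] by simp
  then show ?thesis
    using emb_simps(1)[OF assms] i(6) unfolding conjugates_def is_root_def by simp
qed

text \<open>The extension sends \<open>p(x)\<close> to the value at \<open>y\<close> of
  \<open>p\<close> with \<open>f\<close> applied to its coefficients. Polynomials with the same
  value at \<open>x\<close> differ by a multiple of \<open>Irr E x\<close>, whose image under
  \<open>f\<close> vanishes at \<open>y\<close>, so this is well defined.\<close>

lemma emb_simple_extension:
  assumes E: "ext E" and f: "f \<in> emb E" and x: "x \<in> carrier \<Omega>" and y: "y \<in> carrier \<Omega>"
    and root: "eval (map f (Irr E x)) y = \<zero>"
  obtains h where "h \<in> emb (simple_extension E x)" "\<And>z. z \<in> E \<Longrightarrow> h z = f z" "h x = y"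
proof -
  have Ef: "subfield E \<Omega>" and Er: "subring E \<Omega>" using E subfieldE(1) by auto
  note i = Irr_simps[OF E x]
  interpret E: ring "\<Omega>\<lparr>carrier := E\<rparr>" by (rule subring_is_ring[OF Er])
  interpret EX: cring "E[X]" by (rule univ_poly_is_cring[OF Er])
  interpret f: ring_hom_ring "\<Omega>\<lparr>carrier := E\<rparr>" \<Omega> f
    using f by (intro ring_hom_ringI2 E.ring_axioms ring_axioms) (simp add: emb_def)
  interpret evx: ring_hom_ring "E[X]" \<Omega> "\<lambda>p. eval p x" by (rule eval_ring_hom[OF Er x])
  define ev where "ev p = eval (map f p) y" for p
  have inE: "set p \<subseteq> E" if "p \<in> carrier (E[X])" for p
    using that polynomial_incl univ_poly_carrier by blast
  have fin: "set (map f p) \<subseteq> carrier \<Omega>" if "p \<in> carrier (E[X])" for p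
    using inE[OF that] emb_simps(1)[OF f E] by auto
  have evc: "ev p \<in> carrier \<Omega>" if "p \<in> carrier (E[X])" for p
    unfolding ev_def using fin[OF that] y by (rule eval_in_carrier)
  have ev_add: "ev (p \<oplus>\<^bsub>E[X]\<^esub> q) = ev p \<oplus> ev q" if pq: "p \<in> carrier (E[X])" "q \<in> carrier (E[X])" for p q
  proof -
    have "normalize (map f (poly_add p q)) = poly_add (map f p) (map f q)"
      using f.poly_add_hom'[of p q] inE pq poly_add_consistent[OF Er] by simp
    moreover have "set (map f (poly_add p q)) \<subseteq> carrier \<Omega>"
      using fin[OF EX.a_closed[OF pq]] by (simp add: univ_poly_add)
    ultimately show ?thesis
      unfolding ev_def univ_poly_add using eval_normalize[OF _ y] eval_poly_add[OF fin fin y] pq by metis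
  qed
  have ev_mult: "ev (p \<otimes>\<^bsub>E[X]\<^esub> q) = ev p \<otimes> ev q" if pq: "p \<in> carrier (E[X])" "q \<in> carrier (E[X])" for p q
  proof -
    have "normalize (map f (poly_mult p q)) = poly_mult (map f p) (map f q)"
      using f.poly_mult_hom'[of p q] inE pq poly_mult_consistent[OF Er] by simp
    moreover have "set (map f (poly_mult p q)) \<subseteq> carrier \<Omega>"
      using fin[OF EX.m_closed[OF pq]] by (simp add: univ_poly_mult)
    ultimately show ?thesis
      unfolding ev_def univ_poly_mult using eval_normalize[OF _ y] eval_poly_mult[OF fin fin y] pq by metis
  qed
  have wd: "ev p = ev q"
    if pq: "p \<in> carrier (E[X])" "q \<in> carrier (E[X])" "eval p x = eval q x" for p q
  proof -
    let ?d = "p \<ominus>\<^bsub>E[X]\<^esub> q"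
    have d: "?d \<in> carrier (E[X])" using pq by simp
    have dq: "p = ?d \<oplus>\<^bsub>E[X]\<^esub> q" using pq(1,2) by algebra
    have "eval p x = eval ?d x \<oplus> eval q x"
      using evx.hom_add[OF d pq(2)] dq by simp
    moreover have "eval ?d x \<in> carrier \<Omega>" "eval q x \<in> carrier \<Omega>" using d pq by simp_all
    ultimately have "eval ?d x = \<zero>" using pq(3) by (metis add.l_cancel_one a_comm)
    then have "Irr E x pdivides ?d"
      by (rule Irr_minimal[OF Ef x algebraic_over[OF E x] d])
    then obtain r where r: "r \<in> carrier (E[X])" "?d = Irr E x \<otimes>\<^bsub>E[X]\<^esub> r"
      using pdivides_iff_shell[OF Ef i(1) d] by (auto simp: factor_def)
    have "ev ?d = ev (Irr E x) \<otimes> ev r" using ev_mult[OF i(1) r(1)] r(2) by simp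
    also have "\<dots> = \<zero>" using root evc[OF r(1)] by (simp add: ev_def)
    finally have "ev p = \<zero> \<oplus> ev q" using ev_add[OF d pq(2)] dq by simp
    then show ?thesis using evc[OF pq(2)] by simp
  qed
  have img: "simple_extension E x = (\<lambda>p. eval p x) ` carrier (E[X])"
    by (rule simple_extension_as_eval_img[OF ext_simps(1)[OF E] x])
  define h where "h z = ev (SOME p. p \<in> carrier (E[X]) \<and> eval p x = z)" for z
  have h: "h (eval p x) = ev p" if "p \<in> carrier (E[X])" for p
  proof -
    let ?q = "SOME q. q \<in> carrier (E[X]) \<and> eval q x = eval p x"
    have "?q \<in> carrier (E[X]) \<and> eval ?q x = eval p x" by (rule someI) (use that in simp)
    then show ?thesis unfolding h_def using wd[of ?q p] that by blast
  qed
  have onE: "h z = f z" if z: "z \<in> E" for z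
  proof -
    \<comment> \<open>The constant polynomial has to be normalized because zero is represented by
      the empty list.\<close>
    have c: "normalize [z] \<in> carrier (E[X])"
      using normalize_gives_polynomial[of "[z]" E] z univ_poly_carrier by auto
    have zc: "z \<in> carrier \<Omega>" "f z \<in> carrier \<Omega>" using z ext_simps(4)[OF E] emb_simps(1)[OF f E] by auto
    have "eval (normalize [z]) x = z" "ev (normalize [z]) = f z"
      using zc x y emb_simps(6)[OF f E] by (auto simp: ev_def)
    then show ?thesis using h[OF c] by simp
  qed
  have hx: "h x = y"
    using h[OF var_closed(1)[OF Er]] x y emb_simps(4,6)[OF f E] unfolding ev_def by (simp add: var_def)
  have "h \<in> emb (simple_extension E x)"
  proof (rule embI)
    fix a assume "a \<in> simple_extension E x"
    then obtain p where p: "p \<in> carrier (E[X])" "a = eval p x" unfolding img by blast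
    then show "h a \<in> carrier \<Omega>" using h evc by simp
    fix b assume "b \<in> simple_extension E x"
    then obtain q where q: "q \<in> carrier (E[X])" "b = eval q x" unfolding img by blast
    show "h (a \<oplus> b) = h a \<oplus> h b"
      using h[OF EX.a_closed[OF p(1) q(1)]] evx.hom_add[OF p(1) q(1)] ev_add[OF p(1) q(1)] h p q by simp
    show "h (a \<otimes> b) = h a \<otimes> h b"
      using h[OF EX.m_closed[OF p(1) q(1)]] evx.hom_mult[OF p(1) q(1)] ev_mult[OF p(1) q(1)] h p q by simp
  next
    show "h k = k" if "k \<in> K" for k using onE emb_simps(5)[OF f E] E that by auto
  qed
  then show thesis using that onE hx by blast
qed

text \<open>The leading coefficient 1 is preserved, so the image polynomial keeps its positive
  degree and splits over the algebraically closed field.\<close>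

lemma exists_root_of_image:
  assumes E: "ext E" and f: "f \<in> emb E" and x: "x \<in> carrier \<Omega>"
  obtains y where "y \<in> carrier \<Omega>" "eval (map f (Irr E x)) y = \<zero>"
proof -
  note i = Irr_simps[OF E x]
  let ?p = "map f (Irr E x)"
  have "lead_coeff ?p = \<one>" using i(3,6) emb_simps(4)[OF f E] by (simp add: hd_map)
  then have p: "?p \<in> carrier (poly_ring \<Omega>)"
    using i(5) emb_simps(1)[OF f E] unfolding univ_poly_carrier[symmetric] polynomial_def by auto
  have "size (roots ?p) = degree ?p" using roots_over_carrier[OF p] unfolding splitted_def .
  then have "roots ?p \<noteq> {#}" using i(8) by auto
  then obtain y where "y \<in># roots ?p" by blast
  then have "is_root ?p y" using roots_mem_iff_is_root[OF p] by simp
  then show thesis using that unfolding is_root_def by blast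
qed

lemma emb_finite_extension:
  assumes "ext E" "f \<in> emb E" "set xs \<subseteq> carrier \<Omega>"
  obtains h where "h \<in> emb (finite_extension E xs)" "\<And>z. z \<in> E \<Longrightarrow> h z = f z"
  using assms(3)
proof (induction xs arbitrary: thesis)
  case Nil
  then show ?case using assms(2) by simp
next
  case (Cons x xs)
  then obtain h where h: "h \<in> emb (finite_extension E xs)" "\<And>z. z \<in> E \<Longrightarrow> h z = f z" by auto
  have F: "ext (finite_extension E xs)" by (rule ext_finite_extension) (use assms Cons in auto)
  have x: "x \<in> carrier \<Omega>" using Cons by simp
  obtain y where y: "y \<in> carrier \<Omega>" "eval (map h (Irr (finite_extension E xs) x)) y = \<zero>"
    using exists_root_of_image[OF F h(1) x] .
  obtain h' where h': "h' \<in> emb (simple_extension (finite_extension E xs) x)"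
    "\<And>z. z \<in> finite_extension E xs \<Longrightarrow> h' z = h z"
    by (rule emb_simple_extension[OF F h(1) x y]) blast
  have "E \<subseteq> finite_extension E xs"
    by (rule finite_extension_incl) (use Cons ext_simps(1)[OF assms(1)] in auto)
  then have "h' z = f z" if "z \<in> E" for z using that h'(2) h(2) by (metis subsetD)
  moreover have "h' \<in> emb (finite_extension E (x # xs))" using h'(1) by simp
  ultimately show ?case using Cons(2) by blast
qed

text \<open>First \<open>x\<close> is sent to \<open>y\<close> on \<open>K(x)\<close>, which the
  common minimal polynomial permits, and then the embedding is extended step by step.\<close>

lemma conjugate_emb:
  assumes E: "ext E" "finite_dimension K E" and x: "x \<in> E" and y: "y \<in> conjugates x"
  obtains h where "h \<in> emb E" "h x = y"
proof -
  have xc: "x \<in> carrier \<Omega>" using x ext_simps(4)[OF E(1)] by blast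
  have yr: "y \<in> carrier \<Omega>" "eval (Irr K x) y = \<zero>" using y unfolding conjugates_def is_root_def by auto
  have idK: "id \<in> emb K" using ext_simps(1)[OF ext_K] by (intro embI) auto
  obtain h where h: "h \<in> emb (simple_extension K x)" "h x = y"
    using emb_simple_extension[OF ext_K idK xc yr(1)] yr(2) by auto
  have F: "ext (simple_extension K x)" by (rule ext_simple_extension[OF ext_K xc])
  obtain xs where xs: "set xs \<subseteq> carrier \<Omega>" "Span K xs = E" using finite_basis[OF E(2)] by metis
  \<comment> \<open>Adjoining a \<open>K\<close>-basis of \<open>E\<close> gives a field that
    contains \<open>E\<close>; the embedding is restricted to \<open>E\<close> at the end.\<close>
  let ?F = "finite_extension (simple_extension K x) xs"
  obtain h' where h': "h' \<in> emb ?F" "\<And>z. z \<in> simple_extension K x \<Longrightarrow> h' z = h z"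
    by (rule emb_finite_extension[OF F h(1) xs(1)]) blast
  have Fe: "ext ?F" by (rule ext_finite_extension[OF F xs(1)])
  have "Span K xs \<subseteq> ?F"
    by (rule subalgebra_Span_incl[OF K_field subfield_is_subalgebra])
      (use Fe finite_extension_mem[OF subfieldE(1) xs(1)] F in auto)
  then have "h' \<in> emb E" using emb_mono[OF h'(1) Fe E(1)] xs(2) by simp
  moreover have "h' x = y" using h'(2) h(2) simple_extension_mem[OF subfieldE(1)[OF K_field] xc] by simp
  ultimately show thesis by (rule that)
qed

section \<open>Largest normal subextensions and normal closures\<close>

lemma ext_closedI:
  assumes "K \<subseteq> S" "S \<subseteq> carrier \<Omega>" "\<And>x. x \<in> S \<Longrightarrow> \<ominus> x \<in> S"
    "\<And>x y. x \<in> S \<Longrightarrow> y \<in> S \<Longrightarrow> x \<oplus> y \<in> S" "\<And>x y. x \<in> S \<Longrightarrow> y \<in> S \<Longrightarrow> x \<otimes> y \<in> S"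
  shows "ext S"
  using subring_imp_subfield[OF subringI] assms ext_simps(3)[OF ext_K] by blast

lemma ext_Inter:
  assumes "\<And>E. E \<in> \<E> \<Longrightarrow> ext E" "\<E> \<noteq> {}"
  shows "ext (\<Inter>\<E>)"
proof (rule ext_closedI)
  show "K \<subseteq> \<Inter>\<E>" "\<Inter>\<E> \<subseteq> carrier \<Omega>" using assms ext_simps(1) by blast+
qed (use assms ext_simps(5,6,8) in \<open>meson InterE InterI\<close>)+

text \<open>The largest normal subextension, described through its elements;
  \<open>max_normal_eq\<close> makes the identification.\<close>

definition Nor :: "'a set \<Rightarrow> 'a set" where
  "Nor E = {x \<in> E. conjugates x \<subseteq> E}"

text \<open>A conjugate of a sum or product has the form \<open>h (x \<oplus> y)\<close> or
  \<open>h (x \<otimes> y)\<close> for an embedding \<open>h\<close>, and \<open>h x\<close> and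
  \<open>h y\<close> are conjugates of \<open>x\<close> and \<open>y\<close>, hence in
  \<open>E\<close>.\<close>

lemma ext_Nor:
  assumes E: "ext E" "finite_dimension K E"
  shows "ext (Nor E)"
proof (rule ext_closedI)
  have "conjugates x \<subseteq> {x}" if "x \<in> K" for x
  proof
    fix y assume y: "y \<in> conjugates x"
    have "x \<in> E" using that E(1) by blast
    then obtain h where "h \<in> emb E" "h x = y" by (rule conjugate_emb[OF E _ y])
    then show "y \<in> {x}" using emb_simps(5)[OF _ E(1)] that by auto
  qed
  then show "K \<subseteq> Nor E" using E(1) unfolding Nor_def by blast
  show "Nor E \<subseteq> carrier \<Omega>" using ext_simps(1)[OF E(1)] unfolding Nor_def by blast
  fix x assume x: "x \<in> Nor E"
  then have xE: "x \<in> E" unfolding Nor_def by simp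
  have hx: "h x \<in> E" if "h \<in> emb E" for h
    using emb_conjugates[OF that E(1) xE] x unfolding Nor_def by blast
  have "y \<in> E" if y: "y \<in> conjugates (\<ominus> x)" for y
  proof -
    obtain h where "h \<in> emb E" "h (\<ominus> x) = y"
      using conjugate_emb[OF E ext_simps(5)[OF E(1) xE] y] .
    then show ?thesis using emb_a_inv[OF _ E(1) xE] hx ext_simps(5)[OF E(1)] by metis
  qed
  then show "\<ominus> x \<in> Nor E" using ext_simps(5)[OF E(1) xE] unfolding Nor_def by blast
  fix y assume y: "y \<in> Nor E"
  then have yE: "y \<in> E" unfolding Nor_def by simp
  have hy: "h y \<in> E" if "h \<in> emb E" for h
    using emb_conjugates[OF that E(1) yE] y unfolding Nor_def by blast
  have "w \<in> E" if w: "w \<in> conjugates (x \<oplus> y)" for w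
  proof -
    obtain h where "h \<in> emb E" "h (x \<oplus> y) = w"
      using conjugate_emb[OF E ext_simps(6)[OF E(1) xE yE] w] .
    then show ?thesis using emb_simps(2)[OF _ E(1) xE yE] hx hy ext_simps(6)[OF E(1)] by metis
  qed
  then show "x \<oplus> y \<in> Nor E" using ext_simps(6)[OF E(1) xE yE] unfolding Nor_def by blast
  have "w \<in> E" if w: "w \<in> conjugates (x \<otimes> y)" for w
  proof -
    obtain h where "h \<in> emb E" "h (x \<otimes> y) = w"
      using conjugate_emb[OF E ext_simps(8)[OF E(1) xE yE] w] .
    then show ?thesis using emb_simps(3)[OF _ E(1) xE yE] hx hy ext_simps(8)[OF E(1)] by metis
  qed
  then show "x \<otimes> y \<in> Nor E" using ext_simps(8)[OF E(1) xE yE] unfolding Nor_def by blast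
qed

text \<open>An irreducible polynomial with root \<open>x\<close> is a nonzero constant times
  \<open>Irr K x\<close>, so both have the same roots.\<close>

lemma normal_ext_iff:
  assumes N: "ext N"
  shows "normal_ext \<Omega> K N \<longleftrightarrow> (\<forall>x\<in>N. conjugates x \<subseteq> N)"
proof
  assume n: "normal_ext \<Omega> K N"
  show "\<forall>x\<in>N. conjugates x \<subseteq> N"
  proof
    fix x assume x: "x \<in> N"
    then have xc: "x \<in> carrier \<Omega>" using ext_simps(4)[OF N] by blast
    note i = Irr_simps[OF ext_K xc]
    have "is_root (Irr K x) x" using i(4,6) xc unfolding is_root_def by simp
    then show "conjugates x \<subseteq> N" using n i(1,2) x unfolding normal_ext_def conjugates_def by blast
  qed
next
  assume c: "\<forall>x\<in>N. conjugates x \<subseteq> N"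
  show "normal_ext \<Omega> K N"
    unfolding normal_ext_def
  proof (intro ballI impI allI)
    fix p y assume p: "p \<in> carrier (K[X])" "pirreducible K p" and "\<exists>x\<in>N. is_root p x" and y: "is_root p y"
    then obtain x where x: "x \<in> N" "x \<in> carrier \<Omega>" "eval p x = \<zero>" unfolding is_root_def by blast
    note i = Irr_simps[OF ext_K x(2)]
    have Kr: "subring K \<Omega>" by (rule subfieldE(1)[OF K_field])
    have "Irr K x pdivides p"
      by (rule Irr_minimal[OF K_field x(2) algebraic_extension[OF x(2)] p(1) x(3)])
    then obtain r where r: "r \<in> carrier (K[X])" "p = Irr K x \<otimes>\<^bsub>K[X]\<^esub> r"
      using pdivides_iff_shell[OF K_field i(1) p(1)] by (auto simp: factor_def)
    have "r \<in> Units (K[X])"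
      using pirreducibleE(3)[OF Kr p i(1) r] pirreducibleE(2)[OF Kr i(1,2)] by blast
    then obtain k where k: "k \<in> K - {\<zero>}" "r = [k]" using univ_poly_units[OF K_field] by blast
    have yc: "y \<in> carrier \<Omega>" "eval p y = \<zero>" using y unfolding is_root_def by auto
    have kc: "k \<in> carrier \<Omega>" using k ext_simps(4)[OF ext_K] by blast
    have "eval p y = eval (Irr K x) y \<otimes> eval r y"
      unfolding r(2) univ_poly_mult using i(5) ext_simps(1)[OF ext_K] k yc
      by (intro eval_poly_mult) auto
    then have "eval (Irr K x) y = \<zero>"
      using yc k kc eval_in_carrier[of "Irr K x" y] i(5) ext_simps(1)[OF ext_K] integral by auto
    then have "y \<in> conjugates x" using i(6) yc unfolding conjugates_def is_root_def by simp
    then show "y \<in> N" using c x by blast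
  qed
qed

lemma subextension_iff: "subextension \<Omega> K E F \<longleftrightarrow> ext F \<and> F \<subseteq> E"
  unfolding subextension_def by auto

lemma conjugates_trans:
  assumes "x \<in> carrier \<Omega>" "y \<in> conjugates x"
  shows "conjugates y = conjugates x"
  using conjugates_Irr[OF assms] unfolding conjugates_def by simp

lemma Nor_conjugates:
  assumes "ext E" "x \<in> Nor E"
  shows "conjugates x \<subseteq> Nor E"
  using assms conjugates_trans[OF ext_simps(4)[OF assms(1)]] unfolding Nor_def by blast

lemma max_normal_eq:
  assumes E: "ext E" "finite_dimension K E"
  shows "max_normal \<Omega> K E = Nor E"
  unfolding max_normal_def
proof (rule Greatest_equality)
  show "subextension \<Omega> K E (Nor E) \<and> normal_ext \<Omega> K (Nor E)"
    using ext_Nor[OF E] normal_ext_iff[OF ext_Nor[OF E]] Nor_conjugates[OF E(1)]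
    unfolding subextension_iff by (auto simp: Nor_def)
  show "F \<le> Nor E" if "subextension \<Omega> K E F \<and> normal_ext \<Omega> K F" for F
    using that normal_ext_iff[of F] unfolding subextension_iff Nor_def by blast
qed

text \<open>The intersection of all normal extensions containing \<open>E\<close> is again normal.
  The family is not empty, as the whole algebraic closure belongs to it, so the \<open>LEAST\<close>
  in the definition is attained.\<close>

lemma normal_closure:
  assumes E: "E \<subseteq> carrier \<Omega>"
  shows "ext (normal_closure \<Omega> K E)" "E \<subseteq> normal_closure \<Omega> K E"
    "x \<in> normal_closure \<Omega> K E \<Longrightarrow> conjugates x \<subseteq> normal_closure \<Omega> K E"
proof -
  define \<N> where "\<N> = {N. ext N \<and> normal_ext \<Omega> K N \<and> E \<subseteq> N}"
  have "carrier \<Omega> \<in> \<N>"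
    using ext_carrier normal_ext_iff[OF ext_carrier] conjugates_carrier E unfolding \<N>_def by auto
  then have N: "ext (\<Inter>\<N>)" by (intro ext_Inter) (auto simp: \<N>_def)
  have n: "conjugates x \<subseteq> \<Inter>\<N>" if "x \<in> \<Inter>\<N>" for x
  proof (rule Inter_greatest)
    fix N assume "N \<in> \<N>"
    then show "conjugates x \<subseteq> N" using that normal_ext_iff[of N] unfolding \<N>_def by blast
  qed
  have "normal_closure \<Omega> K E = \<Inter>\<N>"
    unfolding normal_closure_def
  proof (rule Least_equality)
    show "subextension \<Omega> K (carrier \<Omega>) (\<Inter>\<N>) \<and> normal_ext \<Omega> K (\<Inter>\<N>) \<and> E \<subseteq> \<Inter>\<N>"
      using N n normal_ext_iff[OF N] ext_simps(1)[OF N] unfolding subextension_iff by (auto simp: \<N>_def)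
    show "\<Inter>\<N> \<le> N" if "subextension \<Omega> K (carrier \<Omega>) N \<and> normal_ext \<Omega> K N \<and> E \<subseteq> N" for N
      using that unfolding subextension_iff \<N>_def by blast
  qed
  then show "ext (normal_closure \<Omega> K E)" "E \<subseteq> normal_closure \<Omega> K E"
    "x \<in> normal_closure \<Omega> K E \<Longrightarrow> conjugates x \<subseteq> normal_closure \<Omega> K E"
    using N n unfolding \<N>_def by auto
qed


section \<open>Separability\<close>

text \<open>In characteristic zero \<open>q\<close> is 1 and the \<open>q\<close>-th power map is
  the identity, so the statements below need no case distinction on the characteristic.\<close>

abbreviation q :: nat where
  "q \<equiv> char_exponent \<Omega>"

section \<open>The characteristic and the \<open>q\<close>-th power map\<close>

lemma add_pow_one_eq_zero_iff: "add_pow \<Omega> (n::nat) \<one> = \<zero> \<longleftrightarrow> group.ord (add_monoid \<Omega>) \<one> dvd n"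
  using add.pow_eq_id[of \<one> n] by simp

lemma add_pow_eq_mult: "x \<in> carrier \<Omega> \<Longrightarrow> add_pow \<Omega> (n::nat) x = add_pow \<Omega> n \<one> \<otimes> x"
  by (simp add: add_pow_ldistr)

lemma char_prime_or_zero:
  "group.ord (add_monoid \<Omega>) \<one> = 0 \<or> Factorial_Ring.prime (group.ord (add_monoid \<Omega>) \<one>)"
proof (rule disjCI)
  let ?c = "group.ord (add_monoid \<Omega>) \<one>"
  assume np: "\<not> Factorial_Ring.prime ?c"
  show "?c = 0"
  proof (rule ccontr)
    assume c0: "?c \<noteq> 0"
    have c1: "?c \<noteq> 1" using add_pow_one_eq_zero_iff[of 1] one_not_zero by auto
    obtain a b where ab: "?c = a * b" "a \<noteq> 1" "b \<noteq> 1" "a < ?c" "b < ?c"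
    proof -
      obtain a where a: "a dvd ?c" "a \<noteq> 1" "a \<noteq> ?c"
        using np c0 c1 by (metis prime_nat_iff One_nat_def less_one nat_neq_iff)
      then obtain b where b: "?c = a * b" by (auto elim: dvdE)
      then have "b \<noteq> 1" "b \<noteq> ?c" using a c0 by auto
      then show thesis using that[of a b] a b c0 by (metis dvd_imp_le dvd_triv_right le_neq_implies_less neq0_conv)
    qed
    have "add_pow \<Omega> ?c \<one> = add_pow \<Omega> a \<one> \<otimes> add_pow \<Omega> b \<one>"
      unfolding ab(1) by (simp add: add_pow_ldistr add.nat_pow_pow mult.commute)
    then have "add_pow \<Omega> a \<one> \<otimes> add_pow \<Omega> b \<one> = \<zero>" using add_pow_one_eq_zero_iff[of ?c] by simp
    then have "add_pow \<Omega> a \<one> = \<zero> \<or> add_pow \<Omega> b \<one> = \<zero>" by (intro integral) auto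
    then have "?c dvd a \<or> ?c dvd b" using add_pow_one_eq_zero_iff by blast
    then show False using ab c0 by (metis dvd_imp_le mult_is_0 neq0_conv not_le)
  qed
qed

lemma q_cases:
  obtains "q = 1" | "Factorial_Ring.prime q" "group.ord (add_monoid \<Omega>) \<one> = q"
  using char_prime_or_zero unfolding char_exponent_def Let_def by (cases "group.ord (add_monoid \<Omega>) \<one> = 0") auto

lemma q_pos: "q > 0"
  by (rule q_cases) (auto simp: prime_gt_0_nat)

lemma frobenius_add:
  assumes x: "x \<in> carrier \<Omega>" and y: "y \<in> carrier \<Omega>"
  shows "(x \<oplus> y) [^] q = x [^] q \<oplus> y [^] q"
proof (cases rule: q_cases)
  case 1
  then show ?thesis using assms by simp
next
  case 2
  \<comment> \<open>A prime is at least 2. Written this way, the first and the last summand of the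
    binomial expansion split off, and the binomial coefficients between them are divisible by
    \<open>q\<close>.\<close>
  then obtain m where m: "q = Suc (Suc m)"
    by (metis One_nat_def not_prime_0 not_prime_1 old.nat.exhaust)
  let ?f = "\<lambda>k. add_pow \<Omega> (q choose k) (x [^] k \<otimes> y [^] (q - k))"
  have fc: "?f k \<in> carrier \<Omega>" for k using assms by simp
  have z: "?f (Suc k) = \<zero>" if "k \<le> m" for k
  proof -
    have "q dvd (q choose Suc k)" using that m 2(1) by (intro dvd_choose_prime) auto
    then have "add_pow \<Omega> (q choose Suc k) \<one> = \<zero>" using add_pow_one_eq_zero_iff 2(2) by simp
    then show ?thesis
      using assms add_pow_eq_mult[of "x [^] Suc k \<otimes> y [^] (q - Suc k)" "q choose Suc k"] by simp
  qed
  have "(x \<oplus> y) [^] q = (\<Oplus>k\<in>{..Suc (Suc m)}. ?f k)"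
    using binomial[OF assms, of q] m by simp
  also have "\<dots> = ?f (Suc (Suc m)) \<oplus> ((\<Oplus>k\<in>{..m}. ?f (Suc k)) \<oplus> ?f 0)"
    using fc by (subst finsum_Suc, simp, subst finsum_Suc2) auto
  also have "(\<Oplus>k\<in>{..m}. ?f (Suc k)) = \<zero>"
    by (rule add.finprod_one_eqI) (use z in auto)
  finally show ?thesis using assms m by simp
qed

lemma frob_add:
  assumes x: "x \<in> carrier \<Omega>" and y: "y \<in> carrier \<Omega>"
  shows "(x \<oplus> y) [^] (q ^ n) = x [^] (q ^ n) \<oplus> y [^] (q ^ n)"
proof (induction n)
  case (Suc n)
  have "(x \<oplus> y) [^] (q ^ Suc n) = ((x \<oplus> y) [^] (q ^ n)) [^] q"
    using assms by (simp add: nat_pow_pow mult.commute)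
  then show ?case using Suc frobenius_add assms by (simp add: nat_pow_pow mult.commute)
qed (use assms in simp)

lemma frob_zero: "\<zero> [^] (q ^ n) = \<zero>"
  using q_pos by (intro nat_pow_zero) simp

lemma frob_a_inv:
  assumes "x \<in> carrier \<Omega>"
  shows "(\<ominus> x) [^] (q ^ n) = \<ominus> (x [^] (q ^ n))"
proof -
  have "(\<ominus> x) [^] (q ^ n) \<oplus> x [^] (q ^ n) = (\<ominus> x \<oplus> x) [^] (q ^ n)"
    using frob_add[of "\<ominus> x" x n] assms by simp
  also have "\<dots> = \<zero>" using assms frob_zero by (simp add: l_neg)
  finally show ?thesis using assms by (metis minus_equality nat_pow_closed a_inv_closed)
qed

text \<open>The power map is additive and, in a field, only zero has a power equal to zero.\<close>

lemma frob_inj: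
  assumes x: "x \<in> carrier \<Omega>" and y: "y \<in> carrier \<Omega>" and "x [^] (q ^ n) = y [^] (q ^ n)"
  shows "x = y"
proof -
  have nz: "z [^] k \<noteq> \<zero>" if "z \<in> carrier \<Omega>" "z \<noteq> \<zero>" for z and k :: nat
    using that by (induction k) (auto simp: integral_iff)
  have "(x \<ominus> y) [^] (q ^ n) = \<zero>"
    unfolding a_minus_def using frob_add[of x "\<ominus> y" n] frob_a_inv[of y n] assms by (simp add: r_neg)
  then have "x \<ominus> y = \<zero>" using nz[of "x \<ominus> y"] x y by blast
  then show ?thesis using x y by (simp add: r_right_minus_eq)
qed

lemma frob_combine:
  assumes "set ks \<subseteq> carrier \<Omega>" "set us \<subseteq> carrier \<Omega>"
  shows "combine ks us [^] (q ^ n) = combine (map (\<lambda>x. x [^] (q ^ n)) ks) (map (\<lambda>x. x [^] (q ^ n)) us)"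
  using assms
  by (induction ks us rule: combine.induct) (auto simp: frob_add nat_pow_distrib frob_zero)

section \<open>Multiple roots of minimal polynomials and separable elements\<close>

lemma degree_Irr_le:
  assumes "ext E" "x \<in> carrier \<Omega>" "p \<in> carrier (E[X])" "p \<noteq> []" "eval p x = \<zero>"
  shows "degree (Irr E x) \<le> degree p"
proof -
  have E: "subfield E \<Omega>" using assms by simp
  have "Irr E x pdivides p" by (rule Irr_minimal[OF E assms(2) algebraic_over[OF assms(1,2)] assms(3,5)])
  then show ?thesis using pdivides_imp_degree_le[OF subfieldE(1)[OF E] Irr_simps(1)[OF assms(1,2)] assms(3,4)] by simp
qed

text \<open>Puts the product with \<open>X - x\<close> into the form that
  \<open>derivative_telescope\<close> expects.\<close>

lemma linear_factor_coeff:
  assumes x: "x \<in> carrier \<Omega>" and h: "set h \<subseteq> carrier \<Omega>"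
  shows "coeff (poly_mult [\<one>, \<ominus> x] h) i = (if i = 0 then \<zero> else coeff h (i - 1)) \<ominus> x \<otimes> coeff h i"
proof -
  have 1: "set (map ((\<otimes>) \<one>) h @ replicate 1 \<zero>) \<subseteq> carrier \<Omega>" using h by auto
  have 2: "set (map ((\<otimes>) (\<ominus> x)) h @ replicate 0 \<zero>) \<subseteq> carrier \<Omega>" using h x by auto
  have 3: "set (poly_add (map ((\<otimes>) (\<ominus> x)) h @ replicate 0 \<zero>) []) \<subseteq> carrier \<Omega>"
    using poly_add_in_carrier[OF 2, of "[]"] by (simp del: poly_add.simps)
  have "map ((\<otimes>) \<one>) h = h" using h by (intro map_idI) auto
  then have "poly_mult [\<one>, \<ominus> x] h = poly_add (h @ [\<zero>]) (poly_add (map ((\<otimes>) (\<ominus> x)) h) [])"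
    by (simp del: poly_add.simps)
  then have "coeff (poly_mult [\<one>, \<ominus> x] h) i = coeff (h @ [\<zero>]) i \<oplus> (coeff (map ((\<otimes>) (\<ominus> x)) h) i \<oplus> \<zero>)"
    using poly_add_coeff[of "h @ [\<zero>]" "poly_add (map ((\<otimes>) (\<ominus> x)) h) []"]
      poly_add_coeff[of "map ((\<otimes>) (\<ominus> x)) h" "[]"] 1 2 3 h by (simp del: poly_add.simps)
  also have "coeff (map ((\<otimes>) (\<ominus> x)) h) i = \<ominus> x \<otimes> coeff h i"
    using scalar_coeff[of "\<ominus> x" h] x by simp
  also have "coeff (h @ [\<zero>]) i = (if i = 0 then \<zero> else coeff h (i - 1))"
    by (simp add: append_coeff)
  finally show ?thesis using x h by (simp add: a_minus_def l_minus)
qed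

text \<open>The sum is the formal derivative of \<open>p\<close> at \<open>x\<close>. With
  \<open>p = (X - x) h\<close> the derivative at \<open>x\<close> equals \<open>h(x)\<close>, and
  \<open>h\<close> still contains a factor \<open>X - x\<close>.\<close>

lemma derivative_double_root:
  assumes x: "x \<in> carrier \<Omega>" and p: "p \<in> carrier (poly_ring \<Omega>)" "p \<noteq> []" and m: "alg_mult p x \<ge> 2"
    and n: "length p \<le> Suc n"
  shows "(\<Oplus>i\<in>{..<n}. add_pow \<Omega> (Suc i) (coeff p (Suc i)) \<otimes> x [^] i) = \<zero>"
proof -
  interpret UP: domain "poly_ring \<Omega>" by (rule univ_poly_is_domain[OF carrier_is_subring])
  let ?X = "[\<one>, \<ominus> x]"
  have X: "?X \<in> carrier (poly_ring \<Omega>)"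
    using x unfolding univ_poly_carrier[symmetric] polynomial_def by auto
  have "(?X [^]\<^bsub>poly_ring \<Omega>\<^esub> (2::nat)) pdivides p" by (rule le_alg_mult_imp_pdivides[OF x p(1) m])
  then obtain r where r: "r \<in> carrier (poly_ring \<Omega>)" "p = (?X [^]\<^bsub>poly_ring \<Omega>\<^esub> (2::nat)) \<otimes>\<^bsub>poly_ring \<Omega>\<^esub> r"
    unfolding pdivides_def factor_def by blast
  define h where "h = poly_mult ?X r"
  have hc: "h \<in> carrier (poly_ring \<Omega>)" using UP.m_closed[OF X r(1)] unfolding h_def univ_poly_mult .
  then have hs: "set h \<subseteq> carrier \<Omega>" using polynomial_incl univ_poly_carrier by blast
  have rs: "set r \<subseteq> carrier \<Omega>" using r(1) polynomial_incl univ_poly_carrier by blast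
  have "p = ?X \<otimes>\<^bsub>poly_ring \<Omega>\<^esub> (?X \<otimes>\<^bsub>poly_ring \<Omega>\<^esub> r)"
    using r X by (simp add: numeral_2_eq_2 UP.m_assoc)
  then have ph: "p = poly_mult ?X h" unfolding h_def univ_poly_mult .
  have "eval h x = eval ?X x \<otimes> eval r x" unfolding h_def by (rule eval_poly_mult) (use x rs in auto)
  also have "eval ?X x = \<zero>" using x by (simp add: r_neg)
  finally have hx: "eval h x = \<zero>" using eval_in_carrier[OF rs x] by simp
  \<comment> \<open>Large enough for the boundary term \<open>coeff h N\<close> of the telescoping
    sum to vanish and for the sum to include all of \<open>h\<close>.\<close>
  define N where "N = max n (length h)"
  have "(\<Oplus>i\<in>{..<n}. add_pow \<Omega> (Suc i) (coeff p (Suc i)) \<otimes> x [^] i) =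
      (\<Oplus>i\<in>{..<N}. add_pow \<Omega> (Suc i) (coeff p (Suc i)) \<otimes> x [^] i)"
  proof (rule add.finprod_mono_neutral_cong_left)
    have "set p \<subseteq> carrier \<Omega>" using p(1) polynomial_incl univ_poly_carrier by blast
    then show "(\<lambda>i. add_pow \<Omega> (Suc i) (coeff p (Suc i)) \<otimes> x [^] i) \<in> {..<N} \<rightarrow> carrier \<Omega>"
      using x by (auto intro!: m_closed)
    show "add_pow \<Omega> (Suc i) (coeff p (Suc i)) \<otimes> x [^] i = \<zero>" if "i \<in> {..<N} - {..<n}" for i
      using that n x coeff_length[of p "Suc i"] by simp
  qed (auto simp: N_def)
  also have "\<dots> = (\<Oplus>i\<in>{..<N}. add_pow \<Omega> (Suc i) (coeff p (Suc i) \<otimes> x [^] i))"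
  proof -
    have "set p \<subseteq> carrier \<Omega>" using p(1) polynomial_incl univ_poly_carrier by blast
    then show ?thesis using x by (intro finsum_cong' refl) (auto simp: add_pow_ldistr intro!: m_closed simp del: add.nat_pow_Suc)
  qed
  also have "\<dots> = (\<Oplus>i\<in>{..<N}. coeff h i \<otimes> x [^] i) \<ominus> add_pow \<Omega> N (coeff h N \<otimes> x [^] N)"
    by (rule derivative_telescope[OF x]) (use linear_factor_coeff[OF x hs] hs ph in auto)
  also have "(\<Oplus>i\<in>{..<N}. coeff h i \<otimes> x [^] i) = \<zero>"
    using eval_eq_finsum[OF hs x, of N] hx unfolding N_def by simp
  also have "coeff h N = \<zero>" by (rule coeff_length) (simp add: N_def)
  finally show ?thesis using x by (simp add: a_minus_def)
qed

lemma coeff_Irr_mem: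
  assumes "ext E" "x \<in> carrier \<Omega>"
  shows "coeff (Irr E x) i \<in> E"
proof -
  have "coeff (Irr E x) i \<in> range (coeff (Irr E x))" by simp
  then have "coeff (Irr E x) i \<in> set (Irr E x) \<union> {\<zero>}" unfolding coeff_img(3) .
  then show ?thesis using Irr_simps(5)[OF assms] ext_simps(2)[OF assms(1)] by auto
qed

text \<open>The derivative of \<open>Irr K x\<close> vanishes at the multiple root \<open>x\<close>
  but has smaller degree, so it is zero by minimality. Hence \<open>i\<close> times the
  \<open>i\<close>-th coefficient is zero for every \<open>i\<close>. In characteristic zero the
  order is 0 and the conclusion says \<open>i = 0\<close>.\<close>

lemma inseparable_coeff:
  assumes x: "x \<in> carrier \<Omega>" and m: "alg_mult (Irr K x) x \<noteq> 1" and c: "coeff (Irr K x) i \<noteq> \<zero>"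
  shows "group.ord (add_monoid \<Omega>) \<one> dvd i"
proof (cases i)
  case (Suc j)
  note I = Irr_simps[OF ext_K x]
  let ?p = "Irr K x"
  define n where "n = degree ?p"
  have len: "length ?p = Suc n" using I(6) unfolding n_def by (cases ?p) auto
  have "is_root ?p x" using I(4,6) x unfolding is_root_def by simp
  then have "alg_mult ?p x \<ge> 2" using alg_mult_gt_zero_iff_is_root[OF I(7)] m by (metis One_nat_def Suc_leI le_neq_implies_less numeral_2_eq_2)
  then have s: "(\<Oplus>i\<in>{..<n}. add_pow \<Omega> (Suc i) (coeff ?p (Suc i)) \<otimes> x [^] i) = \<zero>"
    using derivative_double_root[OF x I(7,6)] len by simp
  have cK: "coeff ?p i \<in> K" for i by (rule coeff_Irr_mem[OF ext_K x])
  have aK: "add_pow \<Omega> (k::nat) z \<in> K" if "z \<in> K" for k z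
    using that by (induction k) (auto simp: ext_simps(2,6)[OF ext_K])
  \<comment> \<open>The coefficients of the derivative, leading one first. The first entries may be
    zero, so \<open>d\<close> is normalized before it is treated as a polynomial.\<close>
  define d where "d = map (\<lambda>i. add_pow \<Omega> (Suc i) (coeff ?p (Suc i))) (rev [0..<n])"
  have dK: "set d \<subseteq> K" unfolding d_def using aK cK by (auto simp del: add.nat_pow_Suc)
  have dR: "set d \<subseteq> carrier \<Omega>" using dK ext_simps(1)[OF ext_K] by blast
  have "eval d x = (\<Oplus>i\<in>{..<n}. coeff d i \<otimes> x [^] i)"
    by (rule eval_eq_finsum[OF dR x]) (simp add: d_def)
  also have "\<dots> = (\<Oplus>i\<in>{..<n}. add_pow \<Omega> (Suc i) (coeff ?p (Suc i)) \<otimes> x [^] i)"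
    using cK aK x ext_simps(4)[OF ext_K] unfolding d_def
    by (intro finsum_cong' refl) (auto simp: coeff_map_rev intro!: m_closed simp del: add.nat_pow_Suc)
  finally have "eval (normalize d) x = \<zero>" using s eval_normalize[OF dR x] by simp
  moreover have "normalize d \<in> carrier (K[X])"
    using normalize_gives_polynomial[OF dK] univ_poly_carrier by blast
  moreover have "length (normalize d) \<le> n" using normalize_length_le[of d] unfolding d_def by simp
  ultimately have "normalize d = []"
    using degree_Irr_le[OF ext_K x, of "normalize d"] I(8) unfolding n_def
    by (cases "normalize d") auto
  then have d0: "coeff d k = \<zero>" for k using normalize_coeff[of d] by simp
  have "j < n"
  proof (rule ccontr)
    assume "\<not> j < n"
    then have "coeff ?p i = \<zero>" using len Suc by (intro coeff_length) simp
    then show False using c by simp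
  qed
  then have "add_pow \<Omega> i (coeff ?p i) = \<zero>"
    using d0[of j] coeff_map_rev[of j n] Suc unfolding d_def by metis
  then have "add_pow \<Omega> i \<one> \<otimes> coeff ?p i = \<zero>"
    using add_pow_eq_mult cK ext_simps(4)[OF ext_K] by metis
  then have "add_pow \<Omega> i \<one> = \<zero>" using c cK ext_simps(4)[OF ext_K] integral by (metis add.nat_pow_closed one_closed)
  then show ?thesis using add_pow_one_eq_zero_iff by simp
qed simp

text \<open>If \<open>x\<close> were a multiple root, its minimal polynomial would be a polynomial
  in \<open>X^q\<close>. Then \<open>x^q\<close> would have smaller degree than \<open>x\<close>,
  although by hypothesis \<open>K(x)\<close> is contained in \<open>K(x^q)\<close>.\<close>

lemma alg_mult_eq_oneI:
  assumes x: "x \<in> carrier \<Omega>" and s: "x \<in> simple_extension K (x [^] q)"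
  shows "alg_mult (Irr K x) x = 1"
proof (rule ccontr)
  assume m: "alg_mult (Irr K x) x \<noteq> 1"
  note I = Irr_simps[OF ext_K x]
  let ?p = "Irr K x"
  define n where "n = degree ?p"
  have n1: "n \<ge> 1" using I(8) unfolding n_def .
  have len: "length ?p = Suc n" using I(6) unfolding n_def by (cases ?p) auto
  have lc: "coeff ?p n = \<one>" using lead_coeff_simp[OF I(6)] I(3) unfolding n_def by simp
  have "group.ord (add_monoid \<Omega>) \<one> dvd n" using inseparable_coeff[OF x m, of n] lc by simp
  then have "group.ord (add_monoid \<Omega>) \<one> \<noteq> 0" using n1 by auto
  then have q: "group.ord (add_monoid \<Omega>) \<one> = q" "Factorial_Ring.prime q"
    using char_prime_or_zero unfolding char_exponent_def by (auto simp: Let_def)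
  then have q1: "q > 1" using prime_gt_1_nat by blast
  have qd: "q dvd i" if "coeff ?p i \<noteq> \<zero>" for i using inseparable_coeff[OF x m that] q by simp
  obtain k where k: "n = q * k" using qd[of n] lc by (auto elim: dvdE)
  have cK: "coeff ?p i \<in> K" for i by (rule coeff_Irr_mem[OF ext_K x])
  note cR = ext_simps(4)[OF ext_K cK]
  \<comment> \<open>The polynomial with \<open>Irr K x = g(X^q)\<close>: only exponents divisible by
    \<open>q\<close> carry nonzero coefficients.\<close>
  define g where "g = map (\<lambda>j. coeff ?p (q * j)) (rev [0..<Suc k])"
  have gK: "set g \<subseteq> K" unfolding g_def using cK by auto
  have gR: "set g \<subseteq> carrier \<Omega>" using gK ext_simps(1)[OF ext_K] by blast
  have hd: "hd g = \<one>" "g \<noteq> []" unfolding g_def using lc k by auto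
  have gP: "g \<in> carrier (K[X])" using gK hd unfolding univ_poly_carrier[symmetric] polynomial_def by auto
  have xq: "x [^] q \<in> carrier \<Omega>" using x by simp
  have "eval g (x [^] q) = (\<Oplus>j\<in>{..<Suc k}. coeff g j \<otimes> (x [^] q) [^] j)"
    by (rule eval_eq_finsum[OF gR xq]) (simp add: g_def)
  also have "\<dots> = (\<Oplus>j\<in>{..<Suc k}. coeff ?p (q * j) \<otimes> x [^] (q * j))"
    using cR x unfolding g_def
    by (intro finsum_cong' refl) (auto simp: coeff_map_rev nat_pow_pow simp del: upt_Suc)
  also have "\<dots> = (\<Oplus>i\<in>(*) q ` {..<Suc k}. coeff ?p i \<otimes> x [^] i)"
    using cR x q1 by (intro add.finprod_reindex[symmetric]) (auto simp: inj_on_def)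
  also have "\<dots> = (\<Oplus>i\<in>{..<Suc n}. coeff ?p i \<otimes> x [^] i)"
  proof (rule add.finprod_mono_neutral_cong_left)
    show "(*) q ` {..<Suc k} \<subseteq> {..<Suc n}" using k by (auto simp: less_Suc_eq_le)
    show "coeff ?p i \<otimes> x [^] i = \<zero>" if i: "i \<in> {..<Suc n} - (*) q ` {..<Suc k}" for i
    proof -
      have "coeff ?p i = \<zero>"
      proof (rule ccontr)
        assume "coeff ?p i \<noteq> \<zero>"
        then obtain j where j: "i = q * j" using qd by (auto elim: dvdE)
        then have "j < Suc k" using i k q1 by (simp add: less_Suc_eq_le)
        then show False using i j by blast
      qed
      then show ?thesis using x by simp
    qed
  qed (use cR x in auto)
  also have "\<dots> = eval ?p x"
    using eval_eq_finsum[of ?p x "Suc n"] I(5) ext_simps(1)[OF ext_K] x len by auto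
  finally have "degree (Irr K (x [^] q)) \<le> degree g"
    using degree_Irr_le[OF ext_K xq gP hd(2)] I(4) by simp
  then have "degree (Irr K (x [^] q)) \<le> k" unfolding g_def by simp
  moreover have "k < q * k" using k n1 q1 by simp
  ultimately have dle: "degree (Irr K (x [^] q)) < n" using k by linarith
  have F: "ext (simple_extension K (x [^] q))" by (rule ext_simple_extension[OF ext_K xq])
  have sub: "simple_extension K x \<subseteq> simple_extension K (x [^] q)"
    using simple_extension_subring_incl[of "simple_extension K (x [^] q)" K x] subfieldE(1) F s by blast
  note d = dimension_simple_extension[OF K_field _ algebraic_extension]
  obtain us where us: "independent K us" "length us = n" "Span K us = simple_extension K x" "set us \<subseteq> carrier \<Omega>"
    using exists_base[OF K_field d[OF x x]] unfolding n_def by blast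
  have "n \<le> degree (Irr K (x [^] q))"
    using independent_length_le_dimension[OF K_field d[OF xq xq] us(1)] us(2,3) sub
      Span_base_incl[OF K_field us(4)] by blast
  then show False using dle by simp
qed

text \<open>Over \<open>F = K(x^q)\<close> the minimal polynomial of \<open>x\<close> divides
  \<open>X^q - x^q\<close>, whose only root is \<open>x\<close>. So its degree is the multiplicity
  of \<open>x\<close>, which is at most the multiplicity 1 in \<open>Irr K x\<close>; a linear
  minimal polynomial puts \<open>x\<close> into \<open>F\<close>.\<close>

lemma mem_of_alg_mult_eq_one:
  assumes x: "x \<in> carrier \<Omega>" and m: "alg_mult (Irr K x) x = 1"
  shows "x \<in> simple_extension K (x [^] q)"
proof (cases rule: q_cases)
  case 1
  then show ?thesis using x simple_extension_mem[OF subfieldE(1)[OF K_field] x] by simp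
next
  case 2
  let ?F = "simple_extension K (x [^] q)"
  have xq: "x [^] q \<in> carrier \<Omega>" using x by simp
  have F: "ext ?F" by (rule ext_simple_extension[OF ext_K xq])
  have Ff: "subfield ?F \<Omega>" using F by simp
  note I = Irr_simps[OF F x] and IK = Irr_simps[OF ext_K x]
  obtain m where qm: "q = Suc m" using q_pos gr0_conv_Suc by blast
  \<comment> \<open>This is \<open>X^q - x^q\<close>: appending the constant term raises the degree
    of the monomial from \<open>m\<close> to \<open>Suc m = q\<close>.\<close>
  let ?b = "monom \<one> m @ [\<ominus> (x [^] q)]"
  have bF: "set ?b \<subseteq> ?F"
    using ext_simps(2,3,5)[OF F] simple_extension_mem[OF subfieldE(1)[OF K_field] xq] unfolding monom_def by auto
  have bP: "?b \<in> carrier (?F[X])"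
    using bF unfolding univ_poly_carrier[symmetric] polynomial_def monom_def by auto
  have b_eval: "eval ?b y = y [^] q \<ominus> x [^] q" if "y \<in> carrier \<Omega>" for y
    using eval_append_aux[of "monom \<one> m" "\<ominus> (x [^] q)" y] eval_monom[of \<one> y m] that xq monom_in_carrier[of \<one> m] qm
    by (simp add: a_minus_def)
  have "eval ?b x = \<zero>" using b_eval[OF x] xq by (simp add: r_right_minus_eq)
  then have dv: "Irr ?F x pdivides ?b"
    by (rule Irr_minimal[OF Ff x algebraic_over[OF F x] bP])
  have only: "y = x" if "is_root (Irr ?F x) y" for y
  proof -
    have y: "y \<in> carrier \<Omega>" "eval (Irr ?F x) y = \<zero>" using that unfolding is_root_def by auto
    then have "eval ?b y = \<zero>" using pdivides_imp_root_sharing[OF I(7) dv] by blast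
    then have "y [^] q = x [^] q" using b_eval[OF y(1)] xq y by (simp add: r_right_minus_eq)
    then show ?thesis using frob_inj[of y x 1] x y by simp
  qed
  have "set_mset (roots (Irr ?F x)) \<subseteq> {x}" using only roots_mem_iff_is_root[OF I(7)] by auto
  then have "size (roots (Irr ?F x)) = count (roots (Irr ?F x)) x"
    by (metis set_mset_subset_singletonD count_replicate_mset size_replicate_mset)
  moreover have "size (roots (Irr ?F x)) = degree (Irr ?F x)"
    using roots_over_carrier[OF I(7)] unfolding splitted_def .
  moreover have "Irr ?F x pdivides Irr K x"
  proof (rule Irr_minimal[OF Ff x algebraic_over[OF F x] _ IK(4)])
    show "Irr K x \<in> carrier (?F[X])"
      using IK(1) F unfolding univ_poly_carrier[symmetric] polynomial_def by blast
  qed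
  then have "roots (Irr ?F x) \<subseteq># roots (Irr K x)" by (rule pdivides_imp_roots_incl[OF I(7) IK(7,6)])
  then have "count (roots (Irr ?F x)) x \<le> alg_mult (Irr K x) x"
    unfolding alg_mult_eq_count_roots[OF IK(7)] by (rule mset_subset_eq_count)
  ultimately have "degree (Irr ?F x) = 1" using m I(8) by linarith
  then obtain a b where ab: "Irr ?F x = [a, b]" "a \<in> ?F" "b \<in> ?F" by (rule degree_oneE[OF I(1)])
  then have "x \<oplus> b = \<zero>" using I(3,4) x ext_simps(4)[OF F] by simp
  then have "x = \<ominus> b" using x ext_simps(4)[OF F ab(3)] by (metis minus_equality)
  then show ?thesis using ext_simps(5)[OF F ab(3)] by simp
qed

definition Sep :: "'a set \<Rightarrow> 'a set" where
  "Sep E = {x \<in> E. x \<in> simple_extension K (x [^] q)}"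

lemma simple_extension_emb:
  assumes "f \<in> emb E" "ext E" "x \<in> E" "z \<in> simple_extension K x"
  shows "f z \<in> simple_extension K (f x)"
proof -
  have x: "x \<in> carrier \<Omega>" using assms ext_simps(4) by blast
  have fx: "f x \<in> carrier \<Omega>" using emb_simps(1)[OF assms(1,2,3)] .
  obtain p where p: "p \<in> carrier (K[X])" "z = eval p x"
    using assms(4) simple_extension_as_eval_img[OF ext_simps(1)[OF ext_K] x] by blast
  have pK: "set p \<subseteq> K" using p(1) polynomial_incl univ_poly_carrier by blast
  then have "map f p = p" using emb_simps(5)[OF assms(1,2)] by (intro map_idI) auto
  then have "f z = eval p (f x)" using emb_eval[OF assms(1,2) _ assms(3)] pK assms(2) p(2) by auto
  then show ?thesis using p(1) simple_extension_as_eval_img[OF ext_simps(1)[OF ext_K] fx] by blast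
qed

text \<open>The left side speaks of all roots, the criterion only of \<open>x\<close>. An embedding
  of \<open>K(x)\<close> carries the criterion from \<open>x\<close> to each of its
  conjugates.\<close>

lemma separable_iff:
  assumes x: "x \<in> carrier \<Omega>"
  shows "(\<forall>y. is_root (Irr K x) y \<longrightarrow> alg_mult (Irr K x) y = 1) \<longleftrightarrow> x \<in> simple_extension K (x [^] q)"
proof
  assume "\<forall>y. is_root (Irr K x) y \<longrightarrow> alg_mult (Irr K x) y = 1"
  then show "x \<in> simple_extension K (x [^] q)"
    using mem_of_alg_mult_eq_one[OF x] conjugates_self[OF x] unfolding conjugates_def by blast
next
  assume s: "x \<in> simple_extension K (x [^] q)"
  show "\<forall>y. is_root (Irr K x) y \<longrightarrow> alg_mult (Irr K x) y = 1"
  proof (intro allI impI)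
    fix y assume "is_root (Irr K x) y"
    then have y: "y \<in> conjugates x" unfolding conjugates_def by simp
    have F: "ext (simple_extension K x)" "finite_dimension K (simple_extension K x)"
      using ext_simple_extension[OF ext_K x] finite_dimension_simple_extension[OF K_field x] algebraic_extension[OF x] by auto
    have xF: "x \<in> simple_extension K x" by (rule simple_extension_mem[OF subfieldE(1)[OF K_field] x])
    obtain f where f: "f \<in> emb (simple_extension K x)" "f x = y" by (rule conjugate_emb[OF F xF y])
    have "y \<in> simple_extension K (y [^] q)"
      using simple_extension_emb[OF f(1) F(1) ext_simps(10)[OF F(1) xF] s] f(2)
        emb_simps(7)[OF f(1) F(1) xF] by simp
    then have "alg_mult (Irr K y) y = 1" using alg_mult_eq_oneI y conjugates_carrier by blast
    then show "alg_mult (Irr K x) y = 1" using conjugates_Irr[OF x y] by simp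
  qed
qed

lemma separable_ext_iff:
  assumes "ext E"
  shows "separable_ext \<Omega> K E \<longleftrightarrow> (\<forall>x\<in>E. x \<in> simple_extension K (x [^] q))"
  unfolding separable_ext_def using separable_iff ext_simps(4)[OF assms] by blast

text \<open>For \<open>F = K(a, b)\<close> with \<open>a\<close>, \<open>b\<close> separable, the \<open>q\<close>-th powers of a \<open>K\<close>-basis of \<open>F\<close> span
  \<open>K(a\<^sup>q, b\<^sup>q) = F\<close>, hence are independent. Thus raising to the power \<open>q\<close> preserves independence
  in \<open>F\<close>, and \<open>K(z\<^sup>q)\<close> has the same degree as \<open>K(z)\<close> for every \<open>z \<in> F\<close>.\<close>

lemma separable_finite_extension:
  assumes a: "a \<in> carrier \<Omega>" "a \<in> simple_extension K (a [^] q)"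
    and b: "b \<in> carrier \<Omega>" "b \<in> simple_extension K (b [^] q)"
    and z: "z \<in> finite_extension K [a, b]"
  shows "z \<in> simple_extension K (z [^] q)"
proof -
  let ?F = "finite_extension K [a, b]" and ?F' = "finite_extension K [a [^] q, b [^] q]"
  have aq: "a [^] q \<in> carrier \<Omega>" "b [^] q \<in> carrier \<Omega>" using a b by auto
  have F: "ext ?F" by (rule ext_finite_extension[OF ext_K]) (use a b in simp)
  have F': "ext ?F'" by (rule ext_finite_extension[OF ext_K]) (use aq in simp)
  have memF: "a \<in> ?F" "b \<in> ?F"
    using finite_extension_mem[OF subfieldE(1)[OF K_field], of "[a, b]"] a b by auto
  have memF': "a [^] q \<in> ?F'" "b [^] q \<in> ?F'"
    using finite_extension_mem[OF subfieldE(1)[OF K_field], of "[a [^] q, b [^] q]"] aq by auto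
  have F'r: "subring ?F' \<Omega>" using F' subfieldE(1) by blast
  have "a \<in> ?F'" "b \<in> ?F'"
    using simple_extension_subring_incl[OF F'r] F' memF' a(2) b(2) by blast+
  then have FF': "?F \<subseteq> ?F'" using F' by (intro finite_extension_subring_incl[OF F'r]) auto
  have "finite_dimension K ?F"
    by (rule finite_extension_finite_dimension(1)[OF K_field]) (use a b algebraic_extension in auto)
  then obtain n where n: "dimension n K ?F" by blast
  have zc: "z \<in> carrier \<Omega>" using z ext_simps(4)[OF F] by blast
  define m where "m = degree (Irr K z)"
  let ?us = "exp_base z m"
  have us: "independent K ?us"
    unfolding m_def by (rule exp_base_independent[OF K_field zc algebraic_extension[OF zc]])
  have usF: "set ?us \<subseteq> ?F" using ext_simps(10)[OF F z] unfolding exp_base_def by auto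
  \<comment> \<open>The basis of \<open>K(a, b)\<close> is chosen to contain the powers of
    \<open>z\<close>, so that independence of its \<open>q\<close>-th powers yields independence of
    the powers of \<open>z^q\<close>.\<close>
  obtain vs where vs: "length (vs @ ?us) = n" "independent K (vs @ ?us)" "Span K (vs @ ?us) = ?F"
    using complete_base[OF K_field n us usF] by blast
  define ws where "ws = vs @ ?us"
  have ws: "length ws = n" "independent K ws" "Span K ws = ?F" using vs unfolding ws_def by auto
  have wc: "set ws \<subseteq> carrier \<Omega>" using independent_in_carrier[OF ws(2)] .
  have wF: "set ws \<subseteq> ?F" using Span_base_incl[OF K_field wc] ws(3) by simp
  let ?fr = "\<lambda>x. x [^] q"
  let ?S = "Span K (map ?fr ws)"
  have fwc: "set (map ?fr ws) \<subseteq> carrier \<Omega>" using wc by auto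
  have S: "x [^] q \<in> ?S" if x: "x \<in> ?F" for x
  proof -
    have "x \<in> Span K ws" using x ws(3) by simp
    then obtain ks where ks: "set ks \<subseteq> K" "x = combine ks ws"
      using Span_mem_iff_length_version[OF K_field wc] by blast
    have kc: "set ks \<subseteq> carrier \<Omega>" using ks(1) ext_simps(1)[OF ext_K] by blast
    have "x [^] q = combine (map ?fr ks) (map ?fr ws)"
      using frob_combine[OF kc wc, of 1] ks(2) by simp
    moreover have "set (map ?fr ks) \<subseteq> K" using ks(1) ext_simps(10)[OF ext_K] by auto
    ultimately show ?thesis unfolding Span_eq_combine_set[OF K_field fwc] by blast
  qed
  have one: "\<one> \<in> ?S" using S[OF ext_simps(3)[OF F]] by simp
  have "subring ?S \<Omega>"
  proof (rule Span_subring[OF ext_K fwc one])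
    fix u v assume "u \<in> set (map ?fr ws)" "v \<in> set (map ?fr ws)"
    then obtain x y where xy: "x \<in> set ws" "y \<in> set ws" "u = x [^] q" "v = y [^] q" by auto
    then have "x \<in> ?F" "y \<in> ?F" using wF by blast+
    then have "(x \<otimes> y) [^] q \<in> ?S" "x \<in> carrier \<Omega>" "y \<in> carrier \<Omega>"
      using S ext_simps(4,8)[OF F] by blast+
    then show "u \<otimes> v \<in> ?S" using xy nat_pow_distrib by simp
  qed
  moreover have "K \<subseteq> ?S"
  proof
    fix k assume k: "k \<in> K"
    then have "k \<otimes> \<one> \<in> ?S" using Span_smult_closed[OF K_field fwc] one by blast
    then show "k \<in> ?S" using k ext_simps(4)[OF ext_K] by simp
  qed
  ultimately have "?F' \<subseteq> ?S"
    using S memF by (intro finite_extension_subring_incl) auto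
  then have "?F \<subseteq> ?S" using FF' by blast
  then have "independent K (map ?fr ws)"
    using dimension_spanning_list[OF K_field n fwc] ws(1) by simp
  then have "independent K (map ?fr ?us)"
    unfolding ws_def map_append by (rule independent_split(1)[OF K_field])
  moreover have "map ?fr ?us = exp_base (z [^] q) m"
    unfolding exp_base_def using zc by (simp add: nat_pow_pow mult.commute)
  ultimately have ind: "independent K (exp_base (z [^] q) m)" by simp
  have G: "ext (simple_extension K (z [^] q))" "ext (simple_extension K z)"
    using ext_simple_extension[OF ext_K] zc by auto
  have zz: "z \<in> simple_extension K z" "z [^] q \<in> simple_extension K (z [^] q)"
    using simple_extension_mem[OF subfieldE(1)[OF K_field]] zc by auto
  have s1: "set (exp_base (z [^] q) m) \<subseteq> simple_extension K (z [^] q)"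
    using ext_simps(10)[OF G(1) zz(2)] unfolding exp_base_def by auto
  have s2: "simple_extension K (z [^] q) \<subseteq> simple_extension K z"
    using simple_extension_subring_incl[of "simple_extension K z" K "z [^] q"] subfieldE(1) G(2) ext_simps(10)[OF G(2) zz(1)] by blast
  have "dimension m K (simple_extension K z)"
    unfolding m_def by (rule dimension_simple_extension[OF K_field zc algebraic_extension[OF zc]])
  moreover have "length (exp_base (z [^] q) m) = m" unfolding exp_base_def by simp
  \<comment> \<open>These are \<open>m\<close> independent elements of the
    \<open>m\<close>-dimensional space \<open>K(z)\<close>. They span it and lie in
    \<open>K(z^q)\<close>, so \<open>z\<close> lies there too.\<close>
  ultimately have "Span K (exp_base (z [^] q) m) = simple_extension K z"
    using independent_length_eq_dimension[OF K_field _ ind] s1 s2 by blast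
  moreover have "Span K (exp_base (z [^] q) m) \<subseteq> simple_extension K (z [^] q)"
    by (rule subalgebra_Span_incl[OF K_field subfield_is_subalgebra s1]) (use G in auto)
  ultimately show ?thesis using zz(1) by blast
qed

text \<open>Sums, products and negatives of separable elements lie in an extension generated by two
  separable elements, where \<open>separable_finite_extension\<close> applies.\<close>

lemma ext_Sep:
  assumes E: "ext E"
  shows "ext (Sep E)"
proof (rule ext_closedI)
  show "K \<subseteq> Sep E"
  proof
    fix k assume k: "k \<in> K"
    have "k \<in> simple_extension K (k [^] q)"
      using simple_extension_incl[OF ext_simps(1)[OF ext_K], of "k [^] q"] ext_simps(4)[OF ext_K] k by auto
    then show "k \<in> Sep E" using k E unfolding Sep_def by auto
  qed
  show "Sep E \<subseteq> carrier \<Omega>" using ext_simps(1)[OF E] unfolding Sep_def by blast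
  fix x assume x: "x \<in> Sep E"
  then have xs: "x \<in> carrier \<Omega>" "x \<in> simple_extension K (x [^] q)" and xE: "x \<in> E"
    using ext_simps(4)[OF E] unfolding Sep_def by auto
  have F: "ext (finite_extension K [x, y]) \<and> x \<in> finite_extension K [x, y] \<and> y \<in> finite_extension K [x, y]"
    if "y \<in> carrier \<Omega>" for y
    using ext_finite_extension[OF ext_K, of "[x, y]"] that xs(1)
      finite_extension_mem[OF subfieldE(1)[OF K_field], of "[x, y]"] by auto
  have "\<ominus> x \<in> finite_extension K [x, x]" using F[OF xs(1)] ext_simps(5) by blast
  then show "\<ominus> x \<in> Sep E"
    using separable_finite_extension[OF xs xs] ext_simps(5)[OF E xE] unfolding Sep_def by blast
  fix y assume y: "y \<in> Sep E"
  then have ys: "y \<in> carrier \<Omega>" "y \<in> simple_extension K (y [^] q)" and yE: "y \<in> E"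
    using ext_simps(4)[OF E] unfolding Sep_def by auto
  have "x \<oplus> y \<in> finite_extension K [x, y]" "x \<otimes> y \<in> finite_extension K [x, y]"
    using F[OF ys(1)] ext_simps(6,8) by blast+
  then show "x \<oplus> y \<in> Sep E" "x \<otimes> y \<in> Sep E"
    using separable_finite_extension[OF xs ys] ext_simps(6,8)[OF E xE yE] unfolding Sep_def by blast+
qed

lemma max_separable_eq:
  assumes E: "ext E"
  shows "max_separable \<Omega> K E = Sep E"
  unfolding max_separable_def
proof (rule Greatest_equality)
  show "subextension \<Omega> K E (Sep E) \<and> separable_ext \<Omega> K (Sep E)"
    using ext_Sep[OF E] separable_ext_iff[OF ext_Sep[OF E]] unfolding subextension_iff by (auto simp: Sep_def)
  show "F \<le> Sep E" if "subextension \<Omega> K E F \<and> separable_ext \<Omega> K F" for F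
    using that separable_ext_iff[of F] unfolding subextension_iff Sep_def by blast
qed

lemma Sep_conjugates:
  assumes x: "x \<in> carrier \<Omega>" "x \<in> simple_extension K (x [^] q)" and y: "y \<in> conjugates x"
  shows "y \<in> simple_extension K (y [^] q)"
proof -
  have yc: "y \<in> carrier \<Omega>" using y conjugates_carrier by blast
  show ?thesis
    using separable_iff[OF x(1)] separable_iff[OF yc] x(2) conjugates_Irr[OF x(1) y] by simp
qed

text \<open>The nested form lets the result on normal parts of a compositum be applied directly to
  the separable parts. \<open>Gal_eq\<close> shows that it is the intersection of both
  parts.\<close>

definition Gal :: "'a set \<Rightarrow> 'a set" where
  "Gal E = Nor (Sep E)"

lemma Gal_eq:
  assumes "ext E"
  shows "Gal E = Nor E \<inter> Sep E"
  using Sep_conjugates[OF ext_simps(4)[OF assms]] unfolding Gal_def Nor_def Sep_def by blast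

lemma finite_dimension_Sep:
  assumes "ext E" "finite_dimension K E"
  shows "finite_dimension K (Sep E)"
  using finite_dimension_subset[OF assms(2) ext_Sep[OF assms(1)]] unfolding Sep_def by blast

lemma ext_Gal:
  assumes "ext E" "finite_dimension K E"
  shows "ext (Gal E)"
  unfolding Gal_def using ext_Nor[OF ext_Sep[OF assms(1)] finite_dimension_Sep[OF assms]] .

lemma max_galois_eq:
  assumes E: "ext E" "finite_dimension K E"
  shows "max_galois \<Omega> K E = Gal E"
  unfolding max_galois_def galois_ext_def
proof (rule Greatest_equality)
  note S = ext_Sep[OF E(1)] and G = ext_Gal[OF E]
  show "subextension \<Omega> K E (Gal E) \<and> normal_ext \<Omega> K (Gal E) \<and> separable_ext \<Omega> K (Gal E)"
    using G normal_ext_iff[OF G] separable_ext_iff[OF G] Nor_conjugates[OF S] Gal_eq[OF E(1)]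
    unfolding subextension_iff by (auto simp: Sep_def Gal_def)
  show "F \<le> Gal E" if "subextension \<Omega> K E F \<and> normal_ext \<Omega> K F \<and> separable_ext \<Omega> K F" for F
    using that normal_ext_iff[of F] separable_ext_iff[of F] Gal_eq[OF E(1)]
    unfolding subextension_iff Nor_def Sep_def by blast
qed

text \<open>The elements of \<open>E\<close> purely inseparable over \<open>B\<close>. The base
  \<open>K\<close> gives the purely inseparable part, and the compositum of two separable parts is
  the base used in \<open>Sep_compositum\<close>.\<close>

definition insep_over :: "'a set \<Rightarrow> 'a set \<Rightarrow> 'a set" where
  "insep_over B E = {x \<in> E. \<exists>n. x [^] (q ^ n) \<in> B}"

lemma ext_insep_over:
  assumes B: "ext B" and E: "ext E" and BE: "B \<subseteq> E"
  shows "ext (insep_over B E)"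
proof (rule ext_closedI)
  have "x [^] (q ^ 0) \<in> B" if "x \<in> K" for x using that B ext_simps(4)[OF B] by auto
  then show "K \<subseteq> insep_over B E" using E unfolding insep_over_def by blast
  show "insep_over B E \<subseteq> carrier \<Omega>" using ext_simps(1)[OF E] unfolding insep_over_def by blast
  \<comment> \<open>The exponents of two elements may differ; both powers are raised to the common
    exponent \<open>n + m\<close>.\<close>
  have up: "x [^] (q ^ (n + m)) \<in> B" if "x \<in> carrier \<Omega>" "x [^] (q ^ n) \<in> B" for x n m
    using ext_simps(10)[OF B that(2), of "q ^ m"] that(1) by (simp add: nat_pow_pow power_add)
  fix x assume "x \<in> insep_over B E"
  then obtain n where x: "x \<in> E" "x [^] (q ^ n) \<in> B" unfolding insep_over_def by blast
  have xc: "x \<in> carrier \<Omega>" using ext_simps(4)[OF E x(1)] .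
  have "(\<ominus> x) [^] (q ^ n) \<in> B" using frob_a_inv[OF xc] ext_simps(5)[OF B x(2)] by simp
  then show "\<ominus> x \<in> insep_over B E" using ext_simps(5)[OF E x(1)] unfolding insep_over_def by blast
  fix y assume "y \<in> insep_over B E"
  then obtain m where y: "y \<in> E" "y [^] (q ^ m) \<in> B" unfolding insep_over_def by blast
  have yc: "y \<in> carrier \<Omega>" using ext_simps(4)[OF E y(1)] .
  have xy: "x [^] (q ^ (n + m)) \<in> B" "y [^] (q ^ (n + m)) \<in> B"
    using up[OF xc x(2)] up[OF yc y(2), of n] by (auto simp: add.commute)
  have "(x \<oplus> y) [^] (q ^ (n + m)) \<in> B" using frob_add[OF xc yc] ext_simps(6)[OF B xy] by simp
  then show "x \<oplus> y \<in> insep_over B E" using ext_simps(6)[OF E x(1) y(1)] unfolding insep_over_def by blast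
  have "(x \<otimes> y) [^] (q ^ (n + m)) \<in> B" using nat_pow_distrib[OF xc yc] ext_simps(8)[OF B xy] by simp
  then show "x \<otimes> y \<in> insep_over B E" using ext_simps(8)[OF E x(1) y(1)] unfolding insep_over_def by blast
qed

abbreviation PI :: "'a set \<Rightarrow> 'a set" where
  "PI E \<equiv> insep_over K E"

lemma ext_PI: "ext E \<Longrightarrow> ext (PI E)"
  using ext_insep_over[OF ext_K] by blast

lemma max_purely_insep_eq:
  assumes E: "ext E"
  shows "max_purely_insep \<Omega> K E = PI E"
  unfolding max_purely_insep_def
proof (rule Greatest_equality)
  show "subextension \<Omega> K E (PI E) \<and> purely_insep_ext \<Omega> K (PI E)"
    using ext_PI[OF E] unfolding subextension_iff purely_insep_ext_def by (auto simp: insep_over_def)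
  show "F \<le> PI E" if "subextension \<Omega> K E F \<and> purely_insep_ext \<Omega> K F" for F
    using that unfolding subextension_iff purely_insep_ext_def insep_over_def by blast
qed

lemma simple_extension_proper_degree:
  assumes x: "x \<in> carrier \<Omega>" and y: "y \<in> simple_extension K x" and n: "x \<notin> simple_extension K y"
  shows "degree (Irr K y) < degree (Irr K x)"
proof -
  have X: "ext (simple_extension K x)" by (rule ext_simple_extension[OF ext_K x])
  have yc: "y \<in> carrier \<Omega>" using ext_simps(4)[OF X y] .
  note d = dimension_simple_extension[OF K_field _ algebraic_extension]
  have sub: "simple_extension K y \<subseteq> simple_extension K x"
    using simple_extension_subring_incl[of "simple_extension K x" K y] subfieldE(1) X y by blast
  obtain us where us: "set us \<subseteq> carrier \<Omega>" "independent K us" "length us = degree (Irr K y)"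
    "Span K us = simple_extension K y"
    using exists_base[OF K_field d[OF yc yc]] by blast
  have usx: "set us \<subseteq> simple_extension K x" using Span_base_incl[OF K_field us(1)] us(4) sub by blast
  have "length us \<le> degree (Irr K x)"
    by (rule independent_length_le_dimension[OF K_field d[OF x x] us(2) usx])
  moreover have "length us \<noteq> degree (Irr K x)"
    using independent_length_eq_dimension[OF K_field d[OF x x] us(2) usx] us(4) n
      simple_extension_mem[OF subfieldE(1)[OF K_field] x] by auto
  ultimately show ?thesis using us(3) by simp
qed

text \<open>As long as \<open>x\<close> is not in \<open>K(x^q)\<close>, passing to
  \<open>x^q\<close> lowers the degree over \<open>K\<close>, so the process stops at a separable
  power.\<close>

lemma exists_separable_power:
  assumes "x \<in> carrier \<Omega>"
  shows "\<exists>n. x [^] (q ^ n) \<in> simple_extension K ((x [^] (q ^ n)) [^] q)"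
  using assms
proof (induction "degree (Irr K x)" arbitrary: x rule: less_induct)
  case less
  show ?case
  proof (cases "x \<in> simple_extension K (x [^] q)")
    case True
    then show ?thesis using less.prems by (intro exI[of _ 0]) simp
  next
    case False
    have X: "ext (simple_extension K x)" by (rule ext_simple_extension[OF ext_K less.prems])
    have "x [^] q \<in> simple_extension K x"
      using ext_simps(10)[OF X] simple_extension_mem[OF subfieldE(1)[OF K_field] less.prems] by blast
    then have "degree (Irr K (x [^] q)) < degree (Irr K x)"
      by (rule simple_extension_proper_degree[OF less.prems _ False])
    then obtain n where "(x [^] q) [^] (q ^ n) \<in> simple_extension K (((x [^] q) [^] (q ^ n)) [^] q)"
      using less.hyps[of "x [^] q"] less.prems by auto
    moreover have "(x [^] q) [^] (q ^ n) = x [^] (q ^ Suc n)" using less.prems by (simp add: nat_pow_pow)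
    ultimately show ?thesis by metis
  qed
qed

lemma frob_simple_extension:
  assumes "x \<in> carrier \<Omega>" "y \<in> simple_extension K x"
  shows "y [^] (q ^ n) \<in> simple_extension K (x [^] (q ^ n))"
  using assms(2)
proof (induction rule: simple_extension.induct)
  case zero
  then show ?case using frob_zero by simp
next
  case (lin k1 k2)
  have "k1 \<in> carrier \<Omega>" "k2 \<in> carrier \<Omega>"
    using lin ext_simps(4)[OF ext_simple_extension[OF ext_K assms(1)]] ext_simps(4)[OF ext_K] by auto
  then have "(k1 \<otimes> x \<oplus> k2) [^] (q ^ n) = k1 [^] (q ^ n) \<otimes> x [^] (q ^ n) \<oplus> k2 [^] (q ^ n)"
    using frob_add assms(1) nat_pow_distrib by simp
  then show ?case using simple_extension.lin[OF lin.IH] ext_simps(10)[OF ext_K lin.hyps(2)] by simp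
qed

text \<open>Raising \<open>x \<in> K(x^q)\<close> to the power \<open>q^n\<close> gives that
  \<open>x^(q^n)\<close> lies in \<open>K(x^(q^(n+1)))\<close>. So the chain of fields
  \<open>K(x^(q^n))\<close> does not shrink.\<close>

lemma separable_mem_power:
  assumes x: "x \<in> carrier \<Omega>" and s: "x \<in> simple_extension K (x [^] q)"
  shows "x \<in> simple_extension K (x [^] (q ^ n))"
proof (induction n)
  case 0
  then show ?case using x simple_extension_mem[OF subfieldE(1)[OF K_field] x] by simp
next
  case (Suc n)
  have G: "ext (simple_extension K (x [^] (q ^ Suc n)))" by (rule ext_simple_extension[OF ext_K]) (use x in simp)
  have "x [^] (q ^ n) \<in> simple_extension K ((x [^] q) [^] (q ^ n))"
    by (rule frob_simple_extension[OF _ s]) (use x in simp)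
  then have "x [^] (q ^ n) \<in> simple_extension K (x [^] (q ^ Suc n))" using x by (simp add: nat_pow_pow)
  then have "simple_extension K (x [^] (q ^ n)) \<subseteq> simple_extension K (x [^] (q ^ Suc n))"
    using simple_extension_subring_incl subfieldE(1) G by blast
  then show ?case using Suc by blast
qed

text \<open>The elements of the compositum with a \<open>q\<close>-power power in \<open>?S\<close>
  form a field. It contains \<open>A\<close> and \<open>B\<close> by
  \<open>exists_separable_power\<close>, so it is everything.\<close>

lemma Sep_compositum:
  assumes A: "ext A" and B: "ext B"
  shows "Sep (compositum A B) = compositum (Sep A) (Sep B)"
proof
  let ?M = "compositum A B" and ?S = "compositum (Sep A) (Sep B)"
  note M = ext_compositum[OF A B] and sA = ext_Sep[OF A] and sB = ext_Sep[OF B]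
  note S = ext_compositum[OF sA sB]
  have incl: "Sep A \<subseteq> Sep ?M" "Sep B \<subseteq> Sep ?M"
    using compositum_incl[OF A B] unfolding Sep_def by auto
  show "?S \<subseteq> Sep ?M" by (rule compositum_least[OF ext_Sep[OF M] incl])
  have SM: "?S \<subseteq> ?M"
    using compositum_least[OF M] compositum_incl[OF A B] unfolding Sep_def by (metis (no_types, lifting) mem_Collect_eq subset_iff)
  have I: "ext (insep_over ?S ?M)" by (rule ext_insep_over[OF S M SM])
  have sub: "C \<subseteq> insep_over ?S ?M" if C: "ext C" "C \<subseteq> ?M" "Sep C \<subseteq> ?S" for C
  proof
    fix x assume x: "x \<in> C"
    obtain n where "x [^] (q ^ n) \<in> simple_extension K ((x [^] (q ^ n)) [^] q)"
      using exists_separable_power ext_simps(4)[OF C(1) x] by blast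
    then have "x [^] (q ^ n) \<in> Sep C" using ext_simps(10)[OF C(1) x] unfolding Sep_def by blast
    then show "x \<in> insep_over ?S ?M" using C x unfolding insep_over_def by blast
  qed
  have "?M \<subseteq> insep_over ?S ?M"
    by (rule compositum_least[OF I sub sub])
      (use A B compositum_incl[OF A B] compositum_incl[OF sA sB] in auto)
  then show "Sep ?M \<subseteq> ?S"
  proof (intro subsetI)
    fix z assume zM: "?M \<subseteq> insep_over ?S ?M" and z: "z \<in> Sep ?M"
    then obtain n where n: "z [^] (q ^ n) \<in> ?S" unfolding insep_over_def Sep_def by blast
    have "z \<in> simple_extension K (z [^] (q ^ n))"
      using separable_mem_power z ext_simps(4)[OF M] unfolding Sep_def by blast
    then show "z \<in> ?S" using simple_extension_subring_incl[OF _ _ n] S subfieldE(1) by blast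
  qed
qed

text \<open>A separable power \<open>w\<close> of \<open>x\<close> is also fixed by all embeddings,
  so it is the only root of its minimal polynomial, and a simple one. Hence that polynomial is
  linear and \<open>w\<close> lies in \<open>K\<close>.\<close>

lemma mem_PI_of_fixed:
  assumes E: "ext E" "finite_dimension K E" and x: "x \<in> E" and fx: "\<And>f. f \<in> emb E \<Longrightarrow> f x = x"
  shows "x \<in> PI E"
proof -
  have xc: "x \<in> carrier \<Omega>" using ext_simps(4)[OF E(1) x] .
  obtain n where n: "x [^] (q ^ n) \<in> simple_extension K ((x [^] (q ^ n)) [^] q)"
    using exists_separable_power[OF xc] by blast
  define w where "w = x [^] (q ^ n)"
  have w: "w \<in> E" "w \<in> carrier \<Omega>" unfolding w_def using ext_simps(10)[OF E(1) x] xc by auto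
  note I = Irr_simps[OF ext_K w(2)]
  have "y = w" if y: "y \<in> conjugates w" for y
  proof -
    obtain f where "f \<in> emb E" "f w = y" by (rule conjugate_emb[OF E w(1) y])
    then show ?thesis using emb_simps(7)[OF _ E(1) x] fx unfolding w_def by metis
  qed
  then have "set_mset (roots (Irr K w)) \<subseteq> {w}"
    using roots_mem_iff_is_root[OF I(7)] unfolding conjugates_def by auto
  then have "size (roots (Irr K w)) = count (roots (Irr K w)) w"
    by (metis set_mset_subset_singletonD count_replicate_mset size_replicate_mset)
  moreover have "size (roots (Irr K w)) = degree (Irr K w)"
    using roots_over_carrier[OF I(7)] unfolding splitted_def .
  moreover have "count (roots (Irr K w)) w = 1"
    using alg_mult_eq_oneI[OF w(2)] n unfolding w_def[symmetric] alg_mult_eq_count_roots[OF I(7)] by simp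
  ultimately have "degree (Irr K w) = 1" by simp
  then obtain a b where ab: "Irr K w = [a, b]" "a \<in> K" "b \<in> K" by (rule degree_oneE[OF I(1)])
  then have "w \<oplus> b = \<zero>" using I(3,4) w ext_simps(4)[OF ext_K] by simp
  then have "w = \<ominus> b" using w ext_simps(4)[OF ext_K ab(3)] by (metis minus_equality)
  then have "w \<in> K" using ext_simps(5)[OF ext_K ab(3)] by simp
  then show ?thesis using x unfolding insep_over_def w_def by blast
qed

text \<open>The coordinates \<open>bs\<close> lie in \<open>B\<close>, but an embedding of
  \<open>B\<close> may move them outside \<open>B\<close>. Uniqueness is therefore stated for
  coordinates in the larger field \<open>N\<close>. The embedding of the compositum is glued from
  the identity on \<open>A\<close> and \<open>f\<close> on \<open>B\<close>.\<close>

lemma compositum_coordinates: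
  assumes A: "ext A" "finite_dimension K A" and B: "ext B" and N: "ext N" "B \<subseteq> N"
    and ld: "linearly_disjoint \<Omega> K A N" and z: "z \<in> compositum A B"
  obtains as bs where "set as \<subseteq> carrier \<Omega>" "Span K as = A" "length bs = length as" "set bs \<subseteq> B" "z = combine bs as"
    "\<And>f. f \<in> emb B \<Longrightarrow> \<exists>\<phi> \<in> emb (compositum A B). \<phi> z = combine (map f bs) as"
    "\<And>cs. length cs = length as \<Longrightarrow> set cs \<subseteq> N \<Longrightarrow> combine cs as \<in> compositum A B \<Longrightarrow> set cs \<subseteq> B"
    "\<And>cs. length cs = length as \<Longrightarrow> set cs \<subseteq> N \<Longrightarrow> combine cs as = z \<Longrightarrow> cs = bs"
proof -
  obtain as where as: "set as \<subseteq> carrier \<Omega>" "independent K as" "Span K as = A" "set as \<subseteq> A"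
    using finite_basis[OF A(2)] .
  have Nf: "subfield N \<Omega>" and Bf: "subfield B \<Omega>" using N B by auto
  have indN: "independent N as" using ld as(2,4) unfolding linearly_disjoint_def by blast
  have M: "Span B as = compositum A B" by (rule Span_eq_compositum[OF A(1) B as(1,3)])
  have dec: "\<exists>bs. set bs \<subseteq> B \<and> length bs = length as \<and> w = combine bs as" if "w \<in> compositum A B" for w
    using that M Span_mem_iff_length_version[OF Bf as(1), of w] by simp
  have uniq: "cs = ds" if "length cs = length as" "set cs \<subseteq> N" "length ds = length as" "set ds \<subseteq> N"
    "combine cs as = combine ds as" for cs ds
  proof -
    have "combine cs as \<in> Span N as" unfolding Span_eq_combine_set[OF Nf as(1)] using that by blast
    from unique_decomposition[OF Nf indN this] show ?thesis using that by metis
  qed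
  obtain bs where bs: "set bs \<subseteq> B" "length bs = length as" "z = combine bs as" using dec[OF z] by blast
  show thesis
  proof (rule that[OF as(1,3) bs(2,1,3)])
    fix f assume f: "f \<in> emb B"
    have idA: "id \<in> emb A" using ext_simps(1)[OF A(1)] by (intro embI) auto
    have ldB: "linearly_disjoint \<Omega> K A B" using linearly_disjoint_mono[OF ld _ N(2,1) B] by blast
    obtain \<phi> where "\<phi> \<in> emb (compositum A B)"
      "\<And>bs as. set bs \<subseteq> B \<Longrightarrow> set as \<subseteq> A \<Longrightarrow> \<phi> (combine bs as) = combine (map f bs) (map id as)"
      by (rule emb_compositum[OF A B ldB idA f]) blast
    then show "\<exists>\<phi> \<in> emb (compositum A B). \<phi> z = combine (map f bs) as"
      using bs as(4) by (intro bexI[of _ \<phi>]) auto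
  next
    fix cs assume cs: "length cs = length as" "set cs \<subseteq> N" "combine cs as \<in> compositum A B"
    obtain ds where ds: "set ds \<subseteq> B" "length ds = length as" "combine cs as = combine ds as"
      using dec[OF cs(3)] by blast
    then have "cs = ds" using uniq[OF cs(1,2) ds(2)] N(2) by blast
    then show "set cs \<subseteq> B" using ds by simp
  next
    fix cs assume "length cs = length as" "set cs \<subseteq> N" "combine cs as = z"
    then show "cs = bs" using uniq[of cs bs] bs N(2) by blast
  qed
qed

text \<open>Moving the coordinates of \<open>z\<close> by an embedding of \<open>B\<close> yields a
  conjugate of \<open>z\<close>, again in the compositum. Its coordinates over \<open>N\<close> are
  unique, so the moved ones lie in \<open>B\<close>: all conjugates of each coordinate are in
  \<open>B\<close>.\<close>

lemma Nor_compositum_left: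
  assumes A: "ext A" "finite_dimension K A" and B: "ext B" "finite_dimension K B" and N: "ext N" "B \<subseteq> N"
    and nN: "\<And>x. x \<in> N \<Longrightarrow> conjugates x \<subseteq> N"
    and ld: "linearly_disjoint \<Omega> K A N"
  shows "Nor (compositum A B) \<subseteq> compositum A (Nor B)"
proof
  fix z assume z: "z \<in> Nor (compositum A B)"
  then have zM: "z \<in> compositum A B" and zn: "conjugates z \<subseteq> compositum A B" unfolding Nor_def by auto
  obtain as bs where as: "set as \<subseteq> carrier \<Omega>" "Span K as = A" and bs: "length bs = length as" "set bs \<subseteq> B" "z = combine bs as"
    and ex: "\<And>f. f \<in> emb B \<Longrightarrow> \<exists>\<phi> \<in> emb (compositum A B). \<phi> z = combine (map f bs) as"
    and mem: "\<And>cs. length cs = length as \<Longrightarrow> set cs \<subseteq> N \<Longrightarrow> combine cs as \<in> compositum A B \<Longrightarrow> set cs \<subseteq> B"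
    by (rule compositum_coordinates[OF A B(1) N ld zM]) blast
  have "b \<in> Nor B" if b: "b \<in> set bs" for b
  proof -
    have bB: "b \<in> B" using b bs by blast
    have "y \<in> B" if y: "y \<in> conjugates b" for y
    proof -
      obtain f where f: "f \<in> emb B" "f b = y" by (rule conjugate_emb[OF B bB y])
      obtain \<phi> where \<phi>: "\<phi> \<in> emb (compositum A B)" "\<phi> z = combine (map f bs) as" using ex[OF f(1)] by blast
      have "\<phi> z \<in> compositum A B"
        using emb_conjugates[OF \<phi>(1) ext_compositum[OF A(1) B(1)] zM] zn by blast
      moreover have "set (map f bs) \<subseteq> N"
        using emb_conjugates[OF f(1) B(1)] bs(2) N(2) nN by fastforce
      ultimately have "set (map f bs) \<subseteq> B" using mem[of "map f bs"] bs(1) \<phi>(2) by simp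
      then show ?thesis using f(2) b by auto
    qed
    then show ?thesis using bB unfolding Nor_def by blast
  qed
  then have "z \<in> Span (Nor B) as"
    using bs Span_mem_iff_length_version[of "Nor B" as z] ext_Nor[OF B] as(1) by blast
  then show "z \<in> compositum A (Nor B)" using Span_eq_compositum[OF A(1) ext_Nor[OF B] as] by simp
qed

text \<open>An embedding fixes \<open>z\<close> because it fixes a power \<open>z^(q^n)\<close> in
  \<open>K\<close> and the power map is injective. By uniqueness it fixes each coordinate, and
  \<open>mem_PI_of_fixed\<close> applies.\<close>

lemma PI_compositum_left:
  assumes A: "ext A" "finite_dimension K A" and B: "ext B" "finite_dimension K B" and N: "ext N" "B \<subseteq> N"
    and nN: "\<And>x. x \<in> N \<Longrightarrow> conjugates x \<subseteq> N"
    and ld: "linearly_disjoint \<Omega> K A N"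
  shows "PI (compositum A B) \<subseteq> compositum A (PI B)"
proof
  fix z assume z: "z \<in> PI (compositum A B)"
  then obtain n where zM: "z \<in> compositum A B" and zn: "z [^] (q ^ n) \<in> K" unfolding insep_over_def by auto
  obtain as bs where as: "set as \<subseteq> carrier \<Omega>" "Span K as = A" and bs: "length bs = length as" "set bs \<subseteq> B" "z = combine bs as"
    and ex: "\<And>f. f \<in> emb B \<Longrightarrow> \<exists>\<phi> \<in> emb (compositum A B). \<phi> z = combine (map f bs) as"
    and uniq: "\<And>cs. length cs = length as \<Longrightarrow> set cs \<subseteq> N \<Longrightarrow> combine cs as = z \<Longrightarrow> cs = bs"
    by (rule compositum_coordinates[OF A B(1) N ld zM]) blast
  note M = ext_compositum[OF A(1) B(1)]
  have "b \<in> PI B" if b: "b \<in> set bs" for b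
  proof (rule mem_PI_of_fixed[OF B])
    show "b \<in> B" using b bs by blast
    fix f assume f: "f \<in> emb B"
    obtain \<phi> where \<phi>: "\<phi> \<in> emb (compositum A B)" "\<phi> z = combine (map f bs) as" using ex[OF f] by blast
    have "\<phi> z [^] (q ^ n) = z [^] (q ^ n)"
      using emb_simps(5)[OF \<phi>(1) M zn] emb_simps(7)[OF \<phi>(1) M zM] by simp
    then have "\<phi> z = z" using frob_inj emb_simps(1)[OF \<phi>(1) M zM] ext_simps(4)[OF M zM] by blast
    moreover have "set (map f bs) \<subseteq> N"
      using emb_conjugates[OF f B(1)] bs(2) N(2) nN by fastforce
    ultimately have "map f bs = bs" using uniq[of "map f bs"] bs(1) \<phi>(2) by simp
    then show "f b = b" using b by (auto simp: list_eq_iff_nth_eq in_set_conv_nth)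
  qed
  then have "z \<in> Span (PI B) as"
    using bs Span_mem_iff_length_version[of "PI B" as z] ext_PI[OF B(1)] as(1) by blast
  then show "z \<in> compositum A (PI B)" using Span_eq_compositum[OF A(1) ext_PI[OF B(1)] as] by simp
qed


section \<open>Linearly disjoint pairs\<close>

lemma finite_dimension_over:
  assumes F: "ext F" and E: "ext E" "finite_dimension K E" and FE: "F \<subseteq> E"
  shows "finite_dimension F E"
proof -
  obtain us where us: "set us \<subseteq> carrier \<Omega>" "Span K us = E" "set us \<subseteq> E"
    using finite_basis[OF E(2)] by metis
  have Ff: "subfield F \<Omega>" using F by simp
  have "Span F us \<subseteq> E"
    by (rule subalgebra_Span_incl[OF Ff subfield_is_subalgebra us(3)]) (use E FE in auto)
  moreover have "E \<subseteq> Span F us"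
    using us(2) F unfolding Span_eq_combine_set[OF K_field us(1)] Span_eq_combine_set[OF Ff us(1)] by blast
  ultimately show ?thesis using Span_finite_dimension[OF Ff us(1)] by simp
qed

lemma dim_tower:
  assumes F: "ext F" and E: "ext E" "finite_dimension K E" and FE: "F \<subseteq> E"
  shows "dim K E = dim K F * dim F E"
proof -
  have Ff: "subfield F \<Omega>" using F by simp
  show ?thesis
    using telescopic_base_dim(2)[OF K_field Ff finite_dimension_subset[OF E(2) F FE] finite_dimension_over[OF assms]]
    unfolding over_def .
qed

lemma dim_pos:
  assumes E: "ext E" "finite_dimension K E"
  shows "dim K E > 0"
proof (rule ccontr)
  assume "\<not> dim K E > 0"
  then have "dimension 0 K E" using finite_dimensionE[OF K_field E(2)] unfolding over_def by simp
  then have "E = {\<zero>}" by (rule dimension_zero[OF K_field])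
  then show False using ext_simps(3)[OF E(1)] one_not_zero by auto
qed

lemma emb_finite_dimension_image:
  assumes f: "f \<in> emb E" and E: "ext E" "finite_dimension K E"
  shows "finite_dimension K (f ` E)"
proof -
  obtain us where us: "set us \<subseteq> carrier \<Omega>" "Span K us = E" "set us \<subseteq> E"
    using finite_basis[OF E(2)] by metis
  have fus: "set (map f us) \<subseteq> carrier \<Omega>" using emb_simps(1)[OF f E(1)] us(3) by auto
  have "f ` E \<subseteq> Span K (map f us)"
  proof
    fix y assume "y \<in> f ` E"
    then obtain x where x: "x \<in> Span K us" "y = f x" using us(2) by blast
    then obtain ks where ks: "set ks \<subseteq> K" "x = combine ks us"
      using Span_mem_iff_length_version[OF K_field us(1)] by blast
    have "map f ks = ks" using ks(1) emb_simps(5)[OF f E(1)] by (intro map_idI) auto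
    then have "y = combine ks (map f us)" using emb_combine[OF f E(1) _ us(3), of ks] ks x(2) E(1) by auto
    then show "y \<in> Span K (map f us)" unfolding Span_eq_combine_set[OF K_field fus] using ks(1) by blast
  qed
  then show ?thesis
    using finite_dimension_subset[OF Span_finite_dimension[OF K_field fus] ext_emb_image[OF f E(1)]] by blast
qed

text \<open>The embedding maps the finite set of conjugates of \<open>a\<close> lying in
  \<open>E\<close> injectively into itself, hence permutes it, so \<open>a\<close> is a
  value.\<close>

lemma emb_endo_surj:
  assumes f: "f \<in> emb E" and E: "ext E" and sub: "f ` E \<subseteq> E"
  shows "f ` E = E"
proof
  show "E \<subseteq> f ` E"
  proof
    fix a assume a: "a \<in> E"
    then have ac: "a \<in> carrier \<Omega>" using ext_simps(4)[OF E] by blast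
    let ?S = "conjugates a \<inter> E"
    have "finite ?S" using finite_number_of_roots[OF Irr_simps(7)[OF ext_K ac]] unfolding conjugates_def by simp
    moreover have "f ` ?S \<subseteq> ?S"
      using emb_conjugates[OF f E] conjugates_trans[OF ac] sub by blast
    moreover have "inj_on f ?S" using emb_inj[OF f E] by (rule inj_on_subset) simp
    ultimately have "f ` ?S = ?S" by (rule endo_inj_surj)
    then show "a \<in> f ` E" using conjugates_self[OF ac] a by blast
  qed
qed (rule sub)

lemma emb_eq_on_compositum:
  assumes A: "ext A" and B: "ext B" and f: "f \<in> emb (compositum A B)" and g: "g \<in> emb (compositum A B)"
    and eq: "\<And>x. x \<in> A \<Longrightarrow> f x = g x" "\<And>x. x \<in> B \<Longrightarrow> f x = g x" and z: "z \<in> compositum A B"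
  shows "f z = g z"
proof -
  let ?M = "compositum A B" and ?E = "{x \<in> compositum A B. f x = g x}"
  note M = ext_compositum[OF A B] and incl = compositum_incl[OF A B]
  note fs = emb_simps[OF f M] emb_a_inv[OF f M] and gs = emb_simps[OF g M] emb_a_inv[OF g M]
  have "ext ?E"
  proof (rule ext_closedI)
    show "?E \<subseteq> carrier \<Omega>" using ext_simps(1)[OF M] by blast
  qed (use M ext_simps(5,6,8)[OF M] fs gs in auto)
  then have "?M \<subseteq> ?E" by (rule compositum_least) (use incl eq in auto)
  then show ?thesis using z by blast
qed

text \<open>For the inclusion from left to right, the elements mapped into the compositum of the
  images form a field containing \<open>A\<close> and \<open>B\<close>.\<close>

lemma emb_image_compositum:
  assumes A: "ext A" and B: "ext B" and f: "f \<in> emb (compositum A B)"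
  shows "f ` compositum A B = compositum (f ` A) (f ` B)"
proof
  let ?M = "compositum A B" and ?C = "compositum (f ` A) (f ` B)"
  note M = ext_compositum[OF A B] and incl = compositum_incl[OF A B]
  note fs = emb_simps[OF f M] emb_a_inv[OF f M]
  have fA: "ext (f ` A)" "ext (f ` B)" 
    using ext_emb_image[OF emb_mono[OF f M A incl(1)] A] ext_emb_image[OF emb_mono[OF f M B incl(2)] B] .
  show "?C \<subseteq> f ` ?M"
    by (rule compositum_least[OF ext_emb_image[OF f M]]) (use incl in auto)
  note C = ext_compositum[OF fA] and inclC = compositum_incl[OF fA]
  have "ext {x \<in> ?M. f x \<in> ?C}"
  proof (rule ext_closedI)
    show "K \<subseteq> {x \<in> ?M. f x \<in> ?C}"
    proof
      fix k assume k: "k \<in> K"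
      then have "k \<in> ?M" "k \<in> ?C" using M C by blast+
      then show "k \<in> {x \<in> ?M. f x \<in> ?C}" using fs(5)[OF k] by simp
    qed
    show "{x \<in> ?M. f x \<in> ?C} \<subseteq> carrier \<Omega>" using ext_simps(1)[OF M] by blast
  qed (use ext_simps(5,6,8)[OF M] ext_simps(5,6,8)[OF C] fs in auto)
  then have "?M \<subseteq> {x \<in> ?M. f x \<in> ?C}" by (rule compositum_least) (use incl inclC in auto)
  then show "f ` ?M \<subseteq> ?C" by blast
qed

lemma ext_isos_iff:
  assumes E: "ext E" and E': "ext E'"
  shows "f \<in> ext_isos \<Omega> K E E' \<longleftrightarrow> f \<in> emb E \<and> f ` E = E'"
proof
  assume "f \<in> ext_isos \<Omega> K E E'"
  then have h: "f \<in> ring_hom (\<Omega>\<lparr>carrier := E\<rparr>) (\<Omega>\<lparr>carrier := E'\<rparr>)" "bij_betw f E E'" "\<forall>x\<in>K. f x = x"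
    unfolding ext_isos_def ring_iso_def by auto
  have "f \<in> emb E"
    using ring_hom_memE[OF h(1), simplified] h(3) ext_simps(4)[OF E'] by (intro embI) auto
  then show "f \<in> emb E \<and> f ` E = E'" using h(2) bij_betw_imp_surj_on by blast
next
  assume f: "f \<in> emb E \<and> f ` E = E'"
  then have fe: "f \<in> emb E" by simp
  note fs = emb_simps[OF fe E]
  have "f \<in> ring_hom (\<Omega>\<lparr>carrier := E\<rparr>) (\<Omega>\<lparr>carrier := E'\<rparr>)"
    by (rule ring_hom_memI) (use fs f in auto)
  moreover have "bij_betw f E E'" using emb_inj[OF fe E] f unfolding bij_betw_def by simp
  ultimately show "f \<in> ext_isos \<Omega> K E E'" using fs(5) unfolding ext_isos_def ring_iso_def by simp
qed

lemma s_ext_eq: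
  assumes E: "ext E"
  shows "s_ext \<Omega> K E = card ((\<lambda>f. f ` E) ` emb E)"
proof -
  have "{E'. subextension \<Omega> K (carrier \<Omega>) E' \<and> ext_isos \<Omega> K E E' \<noteq> {}} = (\<lambda>f. f ` E) ` emb E"
  proof (intro equalityI subsetI)
    fix E' assume "E' \<in> {E'. subextension \<Omega> K (carrier \<Omega>) E' \<and> ext_isos \<Omega> K E E' \<noteq> {}}"
    then obtain f where "ext E'" "f \<in> ext_isos \<Omega> K E E'" unfolding subextension_iff by auto
    then show "E' \<in> (\<lambda>f. f ` E) ` emb E" using ext_isos_iff[OF E] by auto
  next
    fix E' assume "E' \<in> (\<lambda>f. f ` E) ` emb E"
    then obtain f where f: "f \<in> emb E" "E' = f ` E" by blast
    then have E': "ext E'" using ext_emb_image[OF _ E] by simp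
    then have "f \<in> ext_isos \<Omega> K E E'" using ext_isos_iff[OF E] f by simp
    then show "E' \<in> {E'. subextension \<Omega> K (carrier \<Omega>) E' \<and> ext_isos \<Omega> K E E' \<noteq> {}}"
      using E' ext_simps(1)[OF E'] unfolding subextension_iff by auto
  qed
  then show ?thesis unfolding s_ext_def by simp
qed

lemma emb_cong:
  assumes "f \<in> emb E" "ext E" "\<And>x. x \<in> E \<Longrightarrow> g x = f x"
  shows "g \<in> emb E"
proof -
  note fs = emb_simps[OF assms(1,2)]
  show ?thesis
    by (rule embI) (use assms(2,3) fs ext_simps(6,8)[OF assms(2)] in auto)
qed

lemma ext_aut_iff:
  assumes E: "ext E"
  shows "f \<in> ext_aut \<Omega> K E \<longleftrightarrow> f \<in> emb E \<and> f ` E = E \<and> f \<in> extensional E"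
  unfolding ext_aut_def using ext_isos_iff[OF E E] by auto

end

text \<open>Here \<open>N\<close> and \<open>N'\<close> may be any fields closed under conjugates
  that contain \<open>A\<close> and \<open>B\<close>. This makes the assumptions stable under
  exchanging the pair and under shrinking \<open>A\<close> and \<open>B\<close>, as
  \<open>swap\<close> and \<open>sub_pair\<close> record.\<close>

locale disjoint_pair = closure_ext \<Omega> K for \<Omega> (structure) and K +
  fixes A B N N' :: "'a set"
  assumes A: "ext A" and finA: "finite_dimension K A" and B: "ext B" and finB: "finite_dimension K B"
    and N: "ext N" and AN: "A \<subseteq> N" and normN: "\<And>x. x \<in> N \<Longrightarrow> conjugates x \<subseteq> N"
    and N': "ext N'" and BN': "B \<subseteq> N'" and normN': "\<And>x. x \<in> N' \<Longrightarrow> conjugates x \<subseteq> N'"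
    and ld: "linearly_disjoint \<Omega> K N N'"
begin

abbreviation M :: "'a set" where
  "M \<equiv> compositum A B"

lemmas M = ext_compositum[OF A B]
lemmas M_incl = compositum_incl[OF A B]

lemma swap: "disjoint_pair \<Omega> K B A N' N"
proof
  show "linearly_disjoint \<Omega> K N' N"
    using linearly_disjoint_sym[OF K_field _ _ _ _ ld] N N' by blast
qed (use A finA B finB N AN normN N' BN' normN' in auto)

lemma sub_pair:
  assumes "ext A'" "A' \<subseteq> A" "ext B'" "B' \<subseteq> B"
  shows "disjoint_pair \<Omega> K A' B' N N'"
proof
  show "finite_dimension K A'" "finite_dimension K B'"
    using finite_dimension_subset finA finB assms by blast+
qed (use assms N AN normN N' BN' normN' ld in auto)

lemma ld_sub:
  assumes "A' \<subseteq> N" "ext B'" "B' \<subseteq> N'"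
  shows "linearly_disjoint \<Omega> K A' B'"
  using linearly_disjoint_mono[OF ld assms(1,3) N' assms(2)] .

lemma finM: "finite_dimension K M"
  and dimM: "dim K M = dim K A * dim K B"
  using dim_compositum[OF A finA B finB ld_sub[OF AN B BN']] by auto

lemma Nor_left: "Nor M \<subseteq> compositum A (Nor B)"
  by (rule Nor_compositum_left[OF A finA B finB N' BN' normN' ld_sub[OF AN N' order.refl]])

lemma PI_left: "PI M \<subseteq> compositum A (PI B)"
  by (rule PI_compositum_left[OF A finA B finB N' BN' normN' ld_sub[OF AN N' order.refl]])

lemma Nor_subset: "Nor E \<subseteq> E" and PI_subset: "PI E \<subseteq> E" and Sep_subset: "Sep E \<subseteq> E"
  unfolding Nor_def insep_over_def Sep_def by auto

lemma Nor_compositum: "Nor M = compositum (Nor A) (Nor B)"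
proof
  note nA = ext_Nor[OF A finA] and nB = ext_Nor[OF B finB]
  show "compositum (Nor A) (Nor B) \<subseteq> Nor M"
    by (rule compositum_least[OF ext_Nor[OF M finM]]) (use M_incl in \<open>auto simp: Nor_def\<close>)
  interpret P: disjoint_pair \<Omega> K "Nor B" A N' N
    by (rule disjoint_pair.sub_pair[OF swap nB Nor_subset A order.refl])
  \<comment> \<open>All conjugates of \<open>z\<close> are again in \<open>Nor M\<close>, hence in
    the smaller compositum. So \<open>z\<close> is normal there too, and the one-sided inclusion can
    be used with the roles exchanged.\<close>
  have "Nor M \<subseteq> Nor (compositum (Nor B) A)"
  proof
    fix z assume z: "z \<in> Nor M"
    have "conjugates z \<subseteq> compositum A (Nor B)" using Nor_conjugates[OF M z] Nor_left by blast
    moreover have "z \<in> compositum A (Nor B)" using z Nor_left by blast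
    ultimately show "z \<in> Nor (compositum (Nor B) A)" unfolding Nor_def by (simp add: Un_commute)
  qed
  also have "\<dots> \<subseteq> compositum (Nor B) (Nor A)" by (rule P.Nor_left)
  finally show "Nor M \<subseteq> compositum (Nor A) (Nor B)" by (simp add: Un_commute)
qed

lemma PI_compositum: "PI M = compositum (PI A) (PI B)"
proof
  note pA = ext_PI[OF A] and pB = ext_PI[OF B]
  show "compositum (PI A) (PI B) \<subseteq> PI M"
    by (rule compositum_least[OF ext_PI[OF M]]) (use M_incl in \<open>auto simp: insep_over_def\<close>)
  interpret P: disjoint_pair \<Omega> K "PI B" A N' N
    by (rule disjoint_pair.sub_pair[OF swap pB PI_subset A order.refl])
  have "PI M \<subseteq> PI (compositum (PI B) A)"
    using PI_left unfolding insep_over_def by (auto simp: Un_commute)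
  also have "\<dots> \<subseteq> compositum (PI B) (PI A)" by (rule P.PI_left)
  finally show "PI M \<subseteq> compositum (PI A) (PI B)" by (simp add: Un_commute)
qed

lemma Sep_pair: "disjoint_pair \<Omega> K (Sep A) (Sep B) N N'"
  by (rule sub_pair[OF ext_Sep[OF A] Sep_subset ext_Sep[OF B] Sep_subset])

lemma Gal_compositum: "Gal M = compositum (Gal A) (Gal B)"
  using disjoint_pair.Nor_compositum[OF Sep_pair] Sep_compositum[OF A B] unfolding Gal_def by simp

lemma dim_sub:
  assumes "ext A'" "A' \<subseteq> A" "ext B'" "B' \<subseteq> B"
  shows "dim K (compositum A' B') = dim K A' * dim K B'"
  by (rule disjoint_pair.dimM[OF sub_pair[OF assms]])

text \<open>Compare the towers over \<open>K\<close>: the degrees of both composita factor, and the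
  degree of the lower one is positive and cancels.\<close>

lemma dim_quotient:
  assumes A': "ext A'" "A' \<subseteq> A" and B': "ext B'" "B' \<subseteq> B"
  shows "dim (compositum A' B') M = dim A' A * dim B' B"
proof -
  note M' = ext_compositum[OF A'(1) B'(1)]
  have M'M: "compositum A' B' \<subseteq> M"
    by (rule compositum_least[OF M]) (use A'(2) B'(2) M_incl in auto)
  have "dim K (compositum A' B') * dim (compositum A' B') M = dim K M"
    using dim_tower[OF M' M finM M'M] by simp
  also have "\<dots> = (dim K A' * dim A' A) * (dim K B' * dim B' B)"
    using dimM dim_tower[OF A'(1) A finA A'(2)] dim_tower[OF B'(1) B finB B'(2)] by simp
  also have "\<dots> = dim K (compositum A' B') * (dim A' A * dim B' B)"
    using dim_sub[OF assms] by simp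
  finally show ?thesis
    using dim_pos[OF M' finite_dimension_subset[OF finM M' M'M]] by simp
qed

lemma inter_N:
  assumes "f \<in> emb A" "g \<in> emb B"
  shows "compositum (f ` A) (g ` B) \<inter> N = f ` A"
proof (rule compositum_inter_left)
  show "f ` A \<subseteq> N" using emb_conjugates[OF assms(1) A] AN normN by blast
  have "g ` B \<subseteq> N'" using emb_conjugates[OF assms(2) B] BN' normN' by blast
  then show "linearly_disjoint \<Omega> K N (g ` B)" using ld_sub ext_emb_image[OF assms(2) B] by blast
qed (use ext_emb_image assms A B N emb_finite_dimension_image[OF assms(1) A finA] in auto)

lemma emb_M_restrict:
  assumes "f \<in> emb M"
  shows "f \<in> emb A" "f \<in> emb B"
  using emb_mono[OF assms M] A B M_incl by auto

lemma emb_pair: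
  assumes f: "f \<in> emb A" and g: "g \<in> emb B"
  obtains h where "h \<in> emb M" "\<And>x. x \<in> A \<Longrightarrow> h x = f x" "\<And>x. x \<in> B \<Longrightarrow> h x = g x"
    "h ` M = compositum (f ` A) (g ` B)"
proof -
  obtain h where h: "h \<in> emb M" "\<And>x. x \<in> A \<Longrightarrow> h x = f x" "\<And>x. x \<in> B \<Longrightarrow> h x = g x"
    by (rule emb_compositum[OF A finA B ld_sub[OF AN B BN'] f g]) blast
  have "h ` A = f ` A" "h ` B = g ` B" using h(2,3) by auto
  then have "h ` M = compositum (f ` A) (g ` B)" using emb_image_compositum[OF A B h(1)] by simp
  with h show thesis by (rule that)
qed

text \<open>The bijection sends a pair of conjugate fields to its compositum. \<open>inter_N\<close>
  recovers the first member, and its exchanged version the second.\<close>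

lemma s_ext_compositum: "s_ext \<Omega> K M = s_ext \<Omega> K A * s_ext \<Omega> K B"
proof -
  let ?SA = "(\<lambda>f. f ` A) ` emb A" and ?SB = "(\<lambda>f. f ` B) ` emb B" and ?SM = "(\<lambda>f. f ` M) ` emb M"
  interpret S: disjoint_pair \<Omega> K B A N' N by (rule swap)
  have inj: "inj_on (\<lambda>(A', B'). compositum A' B') (?SA \<times> ?SB)"
  proof (rule inj_onI, clarify)
    fix f g f' g' assume e: "f \<in> emb A" "g \<in> emb B" "f' \<in> emb A" "g' \<in> emb B"
      and eq: "compositum (f ` A) (g ` B) = compositum (f' ` A) (g' ` B)"
    have "f ` A = f' ` A" using inter_N[OF e(1,2)] inter_N[OF e(3,4)] eq by simp
    moreover have "g ` B = g' ` B"
      using S.inter_N[OF e(2,1)] S.inter_N[OF e(4,3)] eq by (simp add: Un_commute)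
    ultimately show "f ` A = f' ` A \<and> g ` B = g' ` B" by simp
  qed
  have img: "(\<lambda>(A', B'). compositum A' B') ` (?SA \<times> ?SB) = ?SM"
  proof (intro equalityI subsetI)
    fix E assume "E \<in> (\<lambda>(A', B'). compositum A' B') ` (?SA \<times> ?SB)"
    then obtain f g where fg: "f \<in> emb A" "g \<in> emb B" "E = compositum (f ` A) (g ` B)" by auto
    obtain h where "h \<in> emb M" "h ` M = compositum (f ` A) (g ` B)" by (rule emb_pair[OF fg(1,2)])
    then show "E \<in> ?SM" using fg(3) by blast
  next
    fix E assume "E \<in> ?SM"
    then obtain h where h: "h \<in> emb M" "E = h ` M" by blast
    then have "E = compositum (h ` A) (h ` B)" using emb_image_compositum[OF A B] by simp
    then show "E \<in> (\<lambda>(A', B'). compositum A' B') ` (?SA \<times> ?SB)"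
      using emb_M_restrict[OF h(1)] by (intro image_eqI[of _ _ "(h ` A, h ` B)"]) auto
  qed
  have "card ?SM = card (?SA \<times> ?SB)" using card_image[OF inj] img by simp
  then show ?thesis unfolding s_ext_eq[OF M] s_ext_eq[OF A] s_ext_eq[OF B] by (simp add: card_cartesian_product)
qed

text \<open>The image of \<open>A\<close> consists of conjugates, so it lies in \<open>N\<close>,
  and it lies in \<open>M\<close> as well; but \<open>M \<inter> N\<close> is
  \<open>A\<close>.\<close>

lemma aut_restrict:
  assumes h: "h \<in> emb M" "h ` M = M"
  shows "restrict h A \<in> ext_aut \<Omega> K A"
proof -
  have hA: "h \<in> emb A" by (rule emb_M_restrict(1)[OF h(1)])
  have "h ` A \<subseteq> N" using emb_conjugates[OF hA A] AN normN by blast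
  moreover have "h ` A \<subseteq> M" using h(2) M_incl by blast
  moreover have "M \<inter> N = A" by (rule compositum_inter_left[OF A finA B N AN ld_sub[OF order.refl B BN']])
  ultimately have "h ` A = A" by (intro emb_endo_surj[OF hA A]) blast
  moreover have "restrict h A \<in> emb A" by (rule emb_cong[OF hA A]) simp
  moreover have "restrict h A ` A = h ` A" by auto
  ultimately show ?thesis unfolding ext_aut_iff[OF A] by simp
qed

text \<open>The bijection is restriction to \<open>A\<close> and \<open>B\<close>: it is injective
  because the two fields generate \<open>M\<close>, and surjective by gluing.\<close>

lemma r_ext_compositum: "r_ext \<Omega> K M = r_ext \<Omega> K A * r_ext \<Omega> K B"
proof -
  let ?\<rho> = "\<lambda>h. (restrict h A, restrict h B)"
  interpret S: disjoint_pair \<Omega> K B A N' N by (rule swap)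
  have inj: "inj_on ?\<rho> (ext_aut \<Omega> K M)"
  proof (rule inj_onI)
    fix f g assume f: "f \<in> ext_aut \<Omega> K M" and g: "g \<in> ext_aut \<Omega> K M" and eq: "?\<rho> f = ?\<rho> g"
    have r: "restrict f A = restrict g A" "restrict f B = restrict g B" using eq by auto
    show "f = g"
    proof (rule extensionalityI[of _ M])
      show "f x = g x" if "x \<in> M" for x
      proof (rule emb_eq_on_compositum[OF A B _ _ _ _ that])
        show "f \<in> emb M" "g \<in> emb M" using f g ext_aut_iff[OF M] by auto
        show "f y = g y" if "y \<in> A" for y using fun_cong[OF r(1), of y] that by simp
        show "f y = g y" if "y \<in> B" for y using fun_cong[OF r(2), of y] that by simp
      qed
    qed (use f g in \<open>auto simp: ext_aut_iff[OF M]\<close>)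
  qed
  have img: "?\<rho> ` ext_aut \<Omega> K M = ext_aut \<Omega> K A \<times> ext_aut \<Omega> K B"
  proof (intro equalityI subsetI)
    fix p assume "p \<in> ?\<rho> ` ext_aut \<Omega> K M"
    then obtain h where h: "h \<in> emb M" "h ` M = M" "p = ?\<rho> h" by (auto simp: ext_aut_iff[OF M])
    then show "p \<in> ext_aut \<Omega> K A \<times> ext_aut \<Omega> K B"
      using aut_restrict[OF h(1,2)] S.aut_restrict h(1,2) by (simp add: Un_commute)
  next
    fix p assume "p \<in> ext_aut \<Omega> K A \<times> ext_aut \<Omega> K B"
    then obtain f g where p: "p = (f, g)" and f: "f \<in> emb A" "f ` A = A" "f \<in> extensional A"
      and g: "g \<in> emb B" "g ` B = B" "g \<in> extensional B"
      by (auto simp: ext_aut_iff[OF A] ext_aut_iff[OF B])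
    obtain h where h: "h \<in> emb M" "\<And>x. x \<in> A \<Longrightarrow> h x = f x" "\<And>x. x \<in> B \<Longrightarrow> h x = g x"
      "h ` M = compositum (f ` A) (g ` B)" by (rule emb_pair[OF f(1) g(1)]) blast
    have "restrict h M \<in> emb M" by (rule emb_cong[OF h(1) M]) simp
    then have "restrict h M \<in> ext_aut \<Omega> K M"
      unfolding ext_aut_iff[OF M] using h(4) f(2) g(2) by simp
    moreover have "restrict (restrict h M) A = f"
      by (rule extensionalityI[of _ A]) (use M_incl h(2) f(3) in auto)
    moreover have "restrict (restrict h M) B = g"
      by (rule extensionalityI[of _ B]) (use M_incl h(3) g(3) in auto)
    ultimately show "p \<in> ?\<rho> ` ext_aut \<Omega> K M" unfolding p by (intro image_eqI[of _ _ "restrict h M"]) simp_all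
  qed
  have "card (ext_aut \<Omega> K M) = card (ext_aut \<Omega> K A \<times> ext_aut \<Omega> K B)" using card_image[OF inj] img by simp
  then show ?thesis unfolding r_ext_def by (simp add: card_cartesian_product)
qed

section \<open>The invariants defined by degrees\<close>

lemma l_ext_compositum: "l_ext \<Omega> K M = l_ext \<Omega> K A * l_ext \<Omega> K B"
  unfolding l_ext_def max_separable_eq[OF M] max_separable_eq[OF A] max_separable_eq[OF B]
    Sep_compositum[OF A B] r_ext_compositum
  using dim_quotient[OF ext_Sep[OF A] Sep_subset ext_Sep[OF B] Sep_subset] by simp

lemma t_ext_compositum: "t_ext \<Omega> K M = t_ext \<Omega> K A * t_ext \<Omega> K B"
  unfolding t_ext_def max_galois_eq[OF M finM] max_galois_eq[OF A finA] max_galois_eq[OF B finB] Gal_compositum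
  by (rule dim_sub) (use ext_Gal A finA B finB Gal_eq in \<open>auto simp: Sep_def\<close>)

text \<open>The quotient formula is applied inside the pair of separable parts, whose subfields are
  the Galois parts.\<close>

lemma u_ext_compositum: "u_ext \<Omega> K M = u_ext \<Omega> K A * u_ext \<Omega> K B"
  unfolding u_ext_def max_galois_eq[OF M finM] max_galois_eq[OF A finA] max_galois_eq[OF B finB] Gal_compositum
    max_separable_eq[OF M] max_separable_eq[OF A] max_separable_eq[OF B] Sep_compositum[OF A B]
  by (rule disjoint_pair.dim_quotient[OF Sep_pair]) (use ext_Gal A finA B finB Gal_eq in auto)

lemma i_ext_compositum: "i_ext \<Omega> K M = i_ext \<Omega> K A * i_ext \<Omega> K B"
  unfolding i_ext_def max_purely_insep_eq[OF M] max_purely_insep_eq[OF A] max_purely_insep_eq[OF B] PI_compositum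
  by (rule dim_sub[OF ext_PI[OF A] PI_subset ext_PI[OF B] PI_subset])

lemma a_ext_compositum: "a_ext \<Omega> K M = a_ext \<Omega> K A * a_ext \<Omega> K B"
  unfolding a_ext_def max_normal_eq[OF M finM] max_normal_eq[OF A finA] max_normal_eq[OF B finB] Nor_compositum
  by (rule dim_sub[OF ext_Nor[OF A finA] Nor_subset ext_Nor[OF B finB] Nor_subset])

end

theorem proposition3p7:
  fixes \<Omega> :: "('a, 'b) ring_scheme" and K L J M :: "'a set"
  assumes "algebraic_closure \<Omega> K"
    and "general_normal_magnification \<Omega> K M L J"
  shows "(ring.dim \<Omega> K M = ring.dim \<Omega> K L * ring.dim \<Omega> K J \<and>
          s_ext \<Omega> K M = s_ext \<Omega> K L * s_ext \<Omega> K J) \<and>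
         (r_ext \<Omega> K M = r_ext \<Omega> K L * r_ext \<Omega> K J \<and>
          l_ext \<Omega> K M = l_ext \<Omega> K L * l_ext \<Omega> K J) \<and>
         (t_ext \<Omega> K M = t_ext \<Omega> K L * t_ext \<Omega> K J \<and>
          u_ext \<Omega> K M = u_ext \<Omega> K L * u_ext \<Omega> K J) \<and>
         (i_ext \<Omega> K M = i_ext \<Omega> K L * i_ext \<Omega> K J \<and>
          a_ext \<Omega> K M = a_ext \<Omega> K L * a_ext \<Omega> K J)"
proof -
  interpret closure_ext \<Omega> K by (rule closure_ext.intro[OF assms(1)])
  note g = assms(2)[unfolded general_normal_magnification_def finite_ext_def subextension_iff]
  have L: "ext L" "finite_dimension K L" and J: "ext J" "finite_dimension K J"
    using g finite_dimension_subset[of M L] by auto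
  note cl = normal_closure[OF ext_simps(1)[OF L(1)]] normal_closure[OF ext_simps(1)[OF J(1)]]
  \<comment> \<open>The two normal closures serve as the fields closed under conjugates.\<close>
  interpret disjoint_pair \<Omega> K L J "normal_closure \<Omega> K L" "normal_closure \<Omega> K J"
    by unfold_locales (use L J cl g in auto)
  have "compositum L J = M" using g by blast
  then show ?thesis
    using dimM s_ext_compositum r_ext_compositum l_ext_compositum t_ext_compositum u_ext_compositum
      i_ext_compositum a_ext_compositum by simp
qed

end
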